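(* Let $(f,g)$ be an admissible pair on $\Omega$ with associated holomorphic function $A$ and constants $k,c_0$ (as defined in the context), and suppose $k>0$ and $c_0\neq0$. Then $f$ must be given by $$f=\frac{\pm\gamma'}{\sqrt{|c_0|}}\operatorname{cn}^{-1}\!\Big[\frac{\gamma'}{\gamma}\sqrt{\cosh\big[2\ln\big|\tanh\big(\tfrac{\sqrt{c_0}(z+c_1)}{2}\big)\big|\big]-1}\,,\ \gamma\Big]-C_2,\qquad z=x+iy,$$ the transformation $g$ is given by $$g(s)=\frac{\pm\Lambda'}{\sqrt{|c_0|}}\operatorname{sd}^{-1}\!\Big[\frac{\gamma}{\gamma'\Lambda}\operatorname{cn}\big[\tfrac{\sqrt{|c_0|}}{\gamma'}(s+C_2),\gamma\big],\ \Lambda\Big]+D,$$ and the transformed minimal graph surface is also a minimal graph surface of the same type as $f$, given by $$g\circ f=\frac{\pm\Lambda'}{\sqrt{|c_0|}}\operatorname{cn}^{-1}\!\Big[\frac{\Lambda'}{\Lambda}\sqrt{\cosh\big[2\ln\big|\tanh\big(\tfrac{\sqrt{c_0}(z+c_1)}{2}\big)\big|\big]-1}\,,\ \Lambda\Big]+C_4 .$$ Here $c_1\in\mathbb{C}$ and $C_2,C_4,D\in\mathbb{R}$ are constants, $\gamma,\Lambda\in(0,1)$, $\gamma'=\sqrt{1-\gamma^2}$ and $\Lambda'=\sqrt{1-\Lambda^2}$. The constants $\gamma$ and $\Lambda$ can attain any value between $0$ and $1$, and are treated as arbitrary parameters acting as moduli of the elliptic functions.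
   Context: A minimal graph surface is a smooth $f:\Omega\to\mathbb{R}$ on an open connected $\Omega\subseteq\mathbb{R}^2\cong\mathbb{C}$ satisfying $(1+f_y^2)f_{xx}-2f_{xy}f_xf_y+(1+f_x^2)f_{yy}=0$. A smooth map $g:U\to\mathbb{R}$ ($U\subseteq\mathbb{R}$) is a minimal graph transformation of $f$ if $f(\Omega)\subseteq U$ and $g\circ f$ is a minimal graph surface. Admissible pair: $\Omega$ is simply connected, $f:\Omega\to\mathbb{R}$ is a minimal graph surface with $\|\nabla f\|^2$ nowhere zero, $g:U\to\mathbb{R}$ is a minimal graph transformation of $f$ with $g'^3-g'$ nowhere zero on $U$, and the first characteristic function $h=\frac{g''}{g'^3-g'}$ (which satisfies $\Delta f/\|\nabla f\|^2=h(f)$) is nowhere zero on $f(\Omega)$. Associated $A$, $k$, $c_0$: let $H_1$ be an antiderivative of $h$ on $f(\Omega)$ and $H$ an antiderivative of $e^{-H_1}$ (any fixed choice of integration constants). Then $u=H\circ f$ is harmonic with $u_z\neq0$; write $u=A+\overline{A}$ with $A$ holomorphic on $\Omega$. The function $A$ satisfies $[\ln A'(z)]_{zz}=k\,[A'(z)]^2$ for a real constant $k$. For $k>0$ put $\mathcal{B}=\ln(\sqrt{k}\,A')$; then $\mathcal{B}_{zz}=e^{2\mathcal{B}}$, and $c_0$ is the complex constant with $\mathcal{B}_z^2=e^{2\mathcal{B}}+c_0$. $\sqrt{c_0}$ is a fixed complex square root. Jacobi elliptic functions with modulus $\kappa\in(0,1)$: if $w=\int_0^\phi\frac{d\theta}{\sqrt{1-\kappa^2\sin^2\theta}}$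 then $\operatorname{sn}(w,\kappa)=\sin\phi$, $\operatorname{cn}(w,\kappa)=\cos\phi$, $\operatorname{dn}(w,\kappa)=\sqrt{1-\kappa^2\sin^2\phi}$, and $\operatorname{sd}=\operatorname{sn}/\operatorname{dn}$. $\operatorname{cn}^{-1}(x,\kappa)=\int_x^1\frac{dt}{\sqrt{(1-t^2)(1-\kappa^2+\kappa^2t^2)}}$, and $\operatorname{sd}^{-1}(\cdot,\kappa)$ is the inverse function of $\operatorname{sd}(\cdot,\kappa)$.
   Formalization: In f and g∘f, √(cosh[…]−1) is corrected to √((cosh[…]−1)/2), since the printed f is never a minimal surface; g is given on f(Ω) only, being arbitrary elsewhere; all moduli in (0,1) with γ≠Λ are attained, as γ=Λ forces g'²=1, which is not admissible. *)

theory Defs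
  imports "HOL-Analysis.Analysis"
begin

section \<open>Minimal graph surfaces\<close>

text \<open>The plane is identified with the type of complex numbers: the partial derivatives in
  \<open>x\<close> and \<open>y\<close> are the directional derivatives along \<open>1\<close> and \<open>\<i>\<close>.\<close>

definition pd :: "complex \<Rightarrow> (complex \<Rightarrow> real) \<Rightarrow> complex \<Rightarrow> real" where
  "pd v f z = frechet_derivative f (at z) v"

abbreviation dx :: "(complex \<Rightarrow> real) \<Rightarrow> complex \<Rightarrow> real" where
  "dx \<equiv> pd 1"

abbreviation dy :: "(complex \<Rightarrow> real) \<Rightarrow> complex \<Rightarrow> real" where
  "dy \<equiv> pd \<i>"

text \<open>Smoothness on an open set: every iterated partial derivative (of any order, in any order of
  the variables) is Frechet differentiable, hence continuous.\<close>

definition smooth_plane :: "complex set \<Rightarrow> (complex \<Rightarrow> real) \<Rightarrow> bool" where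
  "smooth_plane \<Omega> f \<longleftrightarrow>
     (\<forall>vs. set vs \<subseteq> {1, \<i>} \<longrightarrow> foldr pd vs f differentiable_on \<Omega>)"

definition smooth_line :: "real set \<Rightarrow> (real \<Rightarrow> real) \<Rightarrow> bool" where
  "smooth_line U g \<longleftrightarrow> (\<forall>n. (deriv ^^ n) g differentiable_on U)"

definition minimal_graph_surface :: "complex set \<Rightarrow> (complex \<Rightarrow> real) \<Rightarrow> bool" where
  "minimal_graph_surface \<Omega> f \<longleftrightarrow>
     open \<Omega> \<and> connected \<Omega> \<and> smooth_plane \<Omega> f \<and>
     (\<forall>z\<in>\<Omega>. (1 + (dy f z)\<^sup>2) * dx (dx f) z - 2 * dy (dx f) z * dx f z * dy f z
             + (1 + (dx f z)\<^sup>2) * dy (dy f) z = 0)"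

definition minimal_graph_transformation ::
  "complex set \<Rightarrow> (complex \<Rightarrow> real) \<Rightarrow> real set \<Rightarrow> (real \<Rightarrow> real) \<Rightarrow> bool" where
  "minimal_graph_transformation \<Omega> f U g \<longleftrightarrow>
     open U \<and> smooth_line U g \<and> f ` \<Omega> \<subseteq> U \<and> minimal_graph_surface \<Omega> (g \<circ> f)"

definition first_characteristic :: "(real \<Rightarrow> real) \<Rightarrow> real \<Rightarrow> real" where
  "first_characteristic g s = deriv (deriv g) s / ((deriv g s) ^ 3 - deriv g s)"

definition admissible_pair ::
  "complex set \<Rightarrow> (complex \<Rightarrow> real) \<Rightarrow> real set \<Rightarrow> (real \<Rightarrow> real) \<Rightarrow> bool" where
  "admissible_pair \<Omega> f U g \<longleftrightarrow>
     simply_connected \<Omega> \<and>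
     minimal_graph_surface \<Omega> f \<and>
     (\<forall>z\<in>\<Omega>. (dx f z)\<^sup>2 + (dy f z)\<^sup>2 \<noteq> 0) \<and>
     minimal_graph_transformation \<Omega> f U g \<and>
     (\<forall>s\<in>U. (deriv g s) ^ 3 - deriv g s \<noteq> 0) \<and>
     (\<forall>s\<in>f ` \<Omega>. first_characteristic g s \<noteq> 0)"

section \<open>The associated function and constants\<close>

text \<open>\<open>H1\<close> and \<open>H\<close> are arbitrary antiderivatives, so all choices of integration constants are
  allowed. For an admissible pair \<open>f ` \<Omega>\<close> is an open interval.\<close>

definition associated_function ::
  "complex set \<Rightarrow> (complex \<Rightarrow> real) \<Rightarrow> (real \<Rightarrow> real) \<Rightarrow> (complex \<Rightarrow> complex) \<Rightarrow> bool" where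
  "associated_function \<Omega> f g A \<longleftrightarrow>
     A holomorphic_on \<Omega> \<and>
     (\<exists>H1 H. (\<forall>s\<in>f ` \<Omega>. (H1 has_real_derivative first_characteristic g s) (at s)) \<and>
             (\<forall>s\<in>f ` \<Omega>. (H has_real_derivative exp (- H1 s)) (at s)) \<and>
             (\<forall>z\<in>\<Omega>. complex_of_real (H (f z)) = A z + cnj (A z)))"

definition holomorphic_log_on ::
  "complex set \<Rightarrow> (complex \<Rightarrow> complex) \<Rightarrow> (complex \<Rightarrow> complex) \<Rightarrow> bool" where
  "holomorphic_log_on \<Omega> F L \<longleftrightarrow> L holomorphic_on \<Omega> \<and> (\<forall>z\<in>\<Omega>. exp (L z) = F z)"

text \<open>The defining identities only involve derivatives and exponentials of the logarithms, so they
  do not depend on the chosen branches.\<close>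

definition associated_k :: "complex set \<Rightarrow> (complex \<Rightarrow> complex) \<Rightarrow> real \<Rightarrow> bool" where
  "associated_k \<Omega> A k \<longleftrightarrow>
     (\<exists>L. holomorphic_log_on \<Omega> (deriv A) L \<and>
          (\<forall>z\<in>\<Omega>. deriv (deriv L) z = of_real k * (deriv A z)\<^sup>2))"

definition associated_c0 ::
  "complex set \<Rightarrow> (complex \<Rightarrow> complex) \<Rightarrow> real \<Rightarrow> complex \<Rightarrow> bool" where
  "associated_c0 \<Omega> A k c0 \<longleftrightarrow>
     (\<exists>B. holomorphic_log_on \<Omega> (\<lambda>z. of_real (sqrt k) * deriv A z) B \<and>
          (\<forall>z\<in>\<Omega>. (deriv B z)\<^sup>2 = exp (2 * B z) + c0))"

section \<open>Jacobi elliptic functions\<close>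

definition ellF :: "real \<Rightarrow> real \<Rightarrow> real" where
  "ellF \<kappa> \<phi> = (LBINT \<theta>=0..\<phi>. 1 / sqrt (1 - \<kappa>\<^sup>2 * (sin \<theta>)\<^sup>2))"

definition jacobi_am :: "real \<Rightarrow> real \<Rightarrow> real" where
  "jacobi_am \<kappa> = inv (ellF \<kappa>)"

definition jacobi_sn :: "real \<Rightarrow> real \<Rightarrow> real" where
  "jacobi_sn \<kappa> w = sin (jacobi_am \<kappa> w)"

definition jacobi_cn :: "real \<Rightarrow> real \<Rightarrow> real" where
  "jacobi_cn \<kappa> w = cos (jacobi_am \<kappa> w)"

definition jacobi_dn :: "real \<Rightarrow> real \<Rightarrow> real" where
  "jacobi_dn \<kappa> w = sqrt (1 - \<kappa>\<^sup>2 * (sin (jacobi_am \<kappa> w))\<^sup>2)"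

definition jacobi_sd :: "real \<Rightarrow> real \<Rightarrow> real" where
  "jacobi_sd \<kappa> w = jacobi_sn \<kappa> w / jacobi_dn \<kappa> w"

definition cn_inv :: "real \<Rightarrow> real \<Rightarrow> real" where
  "cn_inv \<kappa> x = (LBINT t=x..1. 1 / sqrt ((1 - t\<^sup>2) * (1 - \<kappa>\<^sup>2 + \<kappa>\<^sup>2 * t\<^sup>2)))"

text \<open>\<open>sd\<close> is periodic; its inverse is the principal one, with values between \<open>-K\<close> and \<open>K\<close>, where
  \<open>K = ellF \<kappa> (pi/2)\<close> is the quarter period.\<close>

definition sd_interval :: "real \<Rightarrow> real set" where
  "sd_interval \<kappa> = {- ellF \<kappa> (pi / 2) .. ellF \<kappa> (pi / 2)}"

definition sd_inv :: "real \<Rightarrow> real \<Rightarrow> real" where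
  "sd_inv \<kappa> = the_inv_into (sd_interval \<kappa>) (jacobi_sd \<kappa>)"

section \<open>The surfaces and the transformation\<close>

text \<open>The division by 2 under the outer square root is essential: it makes that root equal to
  \<open>\<bar>sinh (ln \<bar>tanh \<dots>\<bar>)\<bar>\<close>. With \<open>cosh (\<dots>) - 1\<close> in place of \<open>(cosh (\<dots>) - 1) / 2\<close> the
  resulting function does not satisfy the minimal surface equation. Here \<open>r\<close> is a square root of
  \<open>c0\<close>.\<close>

definition cn_argument :: "complex \<Rightarrow> complex \<Rightarrow> real \<Rightarrow> complex \<Rightarrow> real" where
  "cn_argument r c1 \<kappa> z =
     sqrt (1 - \<kappa>\<^sup>2) / \<kappa> * sqrt ((cosh (2 * ln (cmod (tanh (r * (z + c1) / 2)))) - 1) / 2)"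

text \<open>The first two conditions say that the expression is meaningful: the logarithm is taken of a
  positive number and the argument of \<open>cn_inv\<close> is in the domain \<open>{-1..1}\<close>.\<close>

definition cn_graph ::
  "complex set \<Rightarrow> complex \<Rightarrow> complex \<Rightarrow> complex \<Rightarrow> real \<Rightarrow> real \<Rightarrow> real \<Rightarrow> (complex \<Rightarrow> real) \<Rightarrow> bool"
where
  "cn_graph \<Omega> c0 r c1 \<kappa> \<sigma> C F \<longleftrightarrow>
     (\<forall>z\<in>\<Omega>. tanh (r * (z + c1) / 2) \<noteq> 0 \<and>
            cn_argument r c1 \<kappa> z \<in> {-1..1} \<and>
            F z = \<sigma> * sqrt (1 - \<kappa>\<^sup>2) / sqrt (cmod c0) * cn_inv \<kappa> (cn_argument r c1 \<kappa> z) + C)"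

definition sd_argument :: "complex \<Rightarrow> real \<Rightarrow> real \<Rightarrow> real \<Rightarrow> real \<Rightarrow> real" where
  "sd_argument c0 \<gamma> \<Lambda> C2 s =
     \<gamma> / (sqrt (1 - \<gamma>\<^sup>2) * \<Lambda>) * jacobi_cn \<gamma> (sqrt (cmod c0) / sqrt (1 - \<gamma>\<^sup>2) * (s + C2))"

definition sd_transformation ::
  "real set \<Rightarrow> complex \<Rightarrow> real \<Rightarrow> real \<Rightarrow> real \<Rightarrow> real \<Rightarrow> real \<Rightarrow> (real \<Rightarrow> real) \<Rightarrow> bool" where
  "sd_transformation S c0 \<gamma> \<Lambda> C2 \<sigma> D g \<longleftrightarrow>
     (\<forall>s\<in>S. sd_argument c0 \<gamma> \<Lambda> C2 s \<in> jacobi_sd \<Lambda> ` sd_interval \<Lambda> \<and>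
            g s = \<sigma> * sqrt (1 - \<Lambda>\<^sup>2) / sqrt (cmod c0) * sd_inv \<Lambda> (sd_argument c0 \<gamma> \<Lambda> C2 s) + D)"

text \<open>All the formulas for \<open>f\<close>, \<open>g\<close> and \<open>g \<circ> f\<close> with given moduli \<open>\<gamma>\<close> and \<open>\<Lambda>\<close>. The three signs
  are independent existentials, since each formula carries its own \<open>\<plusminus>\<close>.\<close>

definition elliptic_representation ::
  "complex set \<Rightarrow> (complex \<Rightarrow> real) \<Rightarrow> (real \<Rightarrow> real) \<Rightarrow> complex \<Rightarrow> complex \<Rightarrow> real \<Rightarrow> real \<Rightarrow> bool"
where
  "elliptic_representation \<Omega> f g c0 r \<gamma> \<Lambda> \<longleftrightarrow>
     (\<exists>c1 C2 C4 D \<sigma>1 \<sigma>2 \<sigma>3.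
        \<sigma>1 \<in> {1, -1} \<and> \<sigma>2 \<in> {1, -1} \<and> \<sigma>3 \<in> {1, -1} \<and>
        cn_graph \<Omega> c0 r c1 \<gamma> \<sigma>1 (- C2) f \<and>
        sd_transformation (f ` \<Omega>) c0 \<gamma> \<Lambda> C2 \<sigma>2 D g \<and>
        minimal_graph_surface \<Omega> (g \<circ> f) \<and>
        cn_graph \<Omega> c0 r c1 \<Lambda> \<sigma>3 C4 (g \<circ> f))"

end

theory Submission
  imports Defs "HOL-Complex_Analysis.Complex_Analysis"
begin

text \<open>The equations for \<open>B\<close> become \<open>w'' = c0 w\<close>, \<open>w'\<^sup>2 = 1 + c0 w\<^sup>2\<close> for \<open>w = exp (- B)\<close>, so
  \<open>w = sinh (r (z + c1)) / r\<close> and, up to an affine change, the harmonic function \<open>H \<circ> f\<close> is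
  \<open>v = ln \<bar>tanh (r (z + c1) / 2)\<bar>\<close>. Writing \<open>v = K \<circ> f\<close>, the minimal surface equation for \<open>f\<close> is
  equivalent to the ordinary differential equation \<open>K'' = - \<bar>c0\<bar> sinh K cosh K\<close>, with first integral
  \<open>K'\<^sup>2 = \<bar>c0\<bar> (\<gamma>\<^sup>2 / (1 - \<gamma>\<^sup>2) - sinh\<^sup>2 K)\<close>; the free integration constant is the modulus \<open>\<gamma>\<close>. The
  transformed surface satisfies the same equation with another constant \<open>\<Lambda>\<close>, because
  \<open>g'' = h (g'\<^sup>3 - g')\<close> and \<open>h = - K'' / K'\<close> make \<open>K'\<^sup>2 (1 - 1 / g'\<^sup>2)\<close> constant. Separating variables gives
  the elliptic integrals. Conversely, inverting solutions of the first-order equations for any two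
  distinct moduli over a common interval of values of \<open>v\<close> gives an admissible pair.\<close>

section \<open>Elliptic integrals\<close>

text \<open>The reduction to an ordinary differential equation works because the curvature quantity
  Re (q^2 cnj q') / |q|^2, with q the complex gradient of v, depends on z only through the value of
  v; so it can be balanced by a function of f alone. The first integrals determine the speeds only
  up to sign, and signs that could vary from point to point would spoil the formulas. This is
  excluded on the interval f(\<Omega>): K' is an exponential up to a positive factor, K has no zero
  because h has none (h = |c0| sinh K cosh K / K'), and g' has no zero because g'^3 - g' has none.
  Hence every sign is constant, and positivity of K'^2 makes both energy constants positive, which
  is exactly the range of |c0| \<kappa>^2 / (1 - \<kappa>^2) over moduli \<kappa>. In the converse
  direction the same facts dictate the choices: v is kept negative so that h does not vanish, and
  distinct moduli keep the two speeds apart, so that g'^2 differs from 1. The remaining obstacle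
  there is smoothness of all orders, obtained from algebras of functions closed under
  differentiation rather than from formulas for higher derivatives.\<close>

lemma one_minus_sin_pos:
  fixes \<kappa> :: real
  assumes "\<bar>\<kappa>\<bar> < 1"
  shows "0 < 1 - \<kappa>\<^sup>2 * (sin \<theta>)\<^sup>2"
proof -
  have "\<kappa>\<^sup>2 * (sin \<theta>)\<^sup>2 \<le> \<kappa>\<^sup>2 * 1"
    by (intro mult_left_mono) (auto simp: abs_square_le_1)
  moreover have "\<kappa>\<^sup>2 < 1" using assms by (simp add: abs_square_less_1)
  ultimately show ?thesis by linarith
qed

lemma ellF_0 [simp]: "ellF \<kappa> 0 = 0"
  unfolding ellF_def zero_ereal_def by simp

lemma has_real_derivative_ellF:
  assumes "\<bar>\<kappa>\<bar> < 1"
  shows "(ellF \<kappa> has_real_derivative 1 / sqrt (1 - \<kappa>\<^sup>2 * (sin \<phi>)\<^sup>2)) (at \<phi>)"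
proof -
  define b where "b = \<bar>\<phi>\<bar> + 1"
  have cont: "continuous_on {-b..b} (\<lambda>\<theta>. 1 / sqrt (1 - \<kappa>\<^sup>2 * (sin \<theta>)\<^sup>2))"
    using one_minus_sin_pos[OF assms] by (intro continuous_intros) (simp_all add: less_imp_neq[symmetric])
  have "((\<lambda>u. LBINT \<theta>=(0::real)..u. 1 / sqrt (1 - \<kappa>\<^sup>2 * (sin \<theta>)\<^sup>2)) has_vector_derivative
          1 / sqrt (1 - \<kappa>\<^sup>2 * (sin \<phi>)\<^sup>2)) (at \<phi> within {-b..b})"
    by (rule interval_integral_FTC2[OF _ _ cont]) (auto simp: b_def)
  hence "(ellF \<kappa> has_vector_derivative 1 / sqrt (1 - \<kappa>\<^sup>2 * (sin \<phi>)\<^sup>2)) (at \<phi> within {-b..b})"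
    by (simp add: ellF_def[abs_def] zero_ereal_def)
  moreover have "at \<phi> within {-b..b} = at \<phi>"
    by (rule at_within_interior) (auto simp: b_def)
  ultimately show ?thesis
    by (simp add: has_real_derivative_iff_has_vector_derivative)
qed

text \<open>The integrand is even, so the derivative of
  \<open>ellF \<kappa> (- x) + ellF \<kappa> x\<close> vanishes. Evenness of cn rests on
  this.\<close>

lemma ellF_minus:
  assumes "\<bar>\<kappa>\<bar> < 1"
  shows "ellF \<kappa> (- \<phi>) = - ellF \<kappa> \<phi>"
proof -
  have "((\<lambda>x. ellF \<kappa> (- x) + ellF \<kappa> x) has_real_derivative 0) (at x)" for x
    using DERIV_add[OF DERIV_chain2[OF has_real_derivative_ellF[OF assms] DERIV_minus[OF DERIV_ident]]
      has_real_derivative_ellF[OF assms], of x] by simp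
  hence "ellF \<kappa> (- \<phi>) + ellF \<kappa> \<phi> = ellF \<kappa> (- 0) + ellF \<kappa> 0"
    by (intro DERIV_isconst_all[of "\<lambda>x. ellF \<kappa> (- x) + ellF \<kappa> x"] allI)
  thus ?thesis by simp
qed

lemma strict_mono_ellF:
  assumes "\<bar>\<kappa>\<bar> < 1"
  shows "strict_mono (ellF \<kappa>)"
proof (rule strict_monoI)
  fix x y :: real assume "x < y"
  thus "ellF \<kappa> x < ellF \<kappa> y"
  proof (rule DERIV_pos_imp_increasing)
    fix t
    have "0 < 1 / sqrt (1 - \<kappa>\<^sup>2 * (sin t)\<^sup>2)" using one_minus_sin_pos[OF assms, of t] by simp
    with has_real_derivative_ellF[OF assms, of t]
    show "\<exists>d. (ellF \<kappa> has_real_derivative d) (at t) \<and> 0 < d"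
      by (intro exI[where x = "1 / sqrt (1 - \<kappa>\<^sup>2 * (sin t)\<^sup>2)"] conjI)
  qed
qed

lemma continuous_on_ellF [continuous_intros]:
  assumes "\<bar>\<kappa>\<bar> < 1" and "continuous_on S f"
  shows "continuous_on S (\<lambda>x. ellF \<kappa> (f x))"
proof -
  have "continuous_on UNIV (ellF \<kappa>)"
    by (rule DERIV_continuous_on, rule has_field_derivative_at_within, rule has_real_derivative_ellF[OF assms(1)])
  thus ?thesis by (rule continuous_on_compose2[OF _ assms(2)]) simp
qed

lemma jacobi_am_ellF:
  assumes "\<bar>\<kappa>\<bar> < 1"
  shows "jacobi_am \<kappa> (ellF \<kappa> \<phi>) = \<phi>"
  unfolding jacobi_am_def by (rule inv_f_f) (rule strict_mono_on_imp_inj_on[OF strict_mono_ellF[OF assms]])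

section \<open>The integral \<open>cn_inv\<close> in terms of the amplitude\<close>

lemma has_real_derivative_ellF_arccos:
  assumes "\<bar>\<kappa>\<bar> < 1" and "-1 < x" "x < 1"
  shows "((\<lambda>x. ellF \<kappa> (arccos x)) has_real_derivative
           - 1 / sqrt ((1 - x\<^sup>2) * (1 - \<kappa>\<^sup>2 + \<kappa>\<^sup>2 * x\<^sup>2))) (at x)"
proof -
  have "(sin (arccos x))\<^sup>2 = 1 - x\<^sup>2"
    using assms by (simp add: sin_arccos abs_square_le_1)
  hence *: "1 - \<kappa>\<^sup>2 * (sin (arccos x))\<^sup>2 = 1 - \<kappa>\<^sup>2 + \<kappa>\<^sup>2 * x\<^sup>2" by (simp only:) (simp add: algebra_simps)
  have "((\<lambda>x. ellF \<kappa> (arccos x)) has_real_derivative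
           1 / sqrt (1 - \<kappa>\<^sup>2 * (sin (arccos x))\<^sup>2) * inverse (- sqrt (1 - x\<^sup>2))) (at x)"
    using DERIV_chain2[OF has_real_derivative_ellF[OF assms(1)] DERIV_arccos] assms(2,3) by simp
  moreover have "1 / a * inverse (- b) = - 1 / (b * a)" for a b :: real
    by (simp add: inverse_eq_divide)
  ultimately show ?thesis by (simp only: * real_sqrt_mult)
qed

text \<open>The integral is improper: the integrand has an inverse square root singularity at 1. The
  antiderivative \<open>- ellF \<kappa> (arccos t)\<close> is nevertheless continuous up to 1, where
  it vanishes, and with a nonnegative integrand its one-sided limits give the integral.\<close>

lemma cn_inv_eq_ellF_arccos:
  assumes "\<bar>\<kappa>\<bar> < 1" and "-1 < x" "x < 1"
  shows "cn_inv \<kappa> x = ellF \<kappa> (arccos x)"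
proof -
  have \<kappa>: "\<kappa>\<^sup>2 < 1" using assms by (simp add: abs_square_less_1)
  have pos: "0 < (1 - t\<^sup>2) * (1 - \<kappa>\<^sup>2 + \<kappa>\<^sup>2 * t\<^sup>2)" if "x < t" "t < 1" for t
  proof (rule mult_pos_pos)
    show "0 < 1 - t\<^sup>2" using that assms by (simp add: abs_square_less_1)
    show "0 < 1 - \<kappa>\<^sup>2 + \<kappa>\<^sup>2 * t\<^sup>2" using \<kappa> by (intro add_pos_nonneg) auto
  qed
  have cont: "continuous_on {-1..1} (\<lambda>t. - ellF \<kappa> (arccos t))"
    by (intro continuous_intros assms) auto
  have lim: "((\<lambda>t. - ellF \<kappa> (arccos t)) \<longlongrightarrow> - ellF \<kappa> (arccos a)) (at a within {-1..1})"
    if "a \<in> {-1..1}" for a using cont that by (simp add: continuous_on_def)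
  have "(LBINT t=ereal x..ereal 1. 1 / sqrt ((1 - t\<^sup>2) * (1 - \<kappa>\<^sup>2 + \<kappa>\<^sup>2 * t\<^sup>2)))
        = 0 - (- ellF \<kappa> (arccos x))"
  proof (rule interval_integral_FTC_nonneg(2))
    show "ereal x < ereal 1" using assms by simp
    show "((\<lambda>t. - ellF \<kappa> (arccos t)) has_real_derivative
            1 / sqrt ((1 - t\<^sup>2) * (1 - \<kappa>\<^sup>2 + \<kappa>\<^sup>2 * t\<^sup>2))) (at t)"
      if "ereal x < ereal t" "ereal t < ereal 1" for t
      using DERIV_minus[OF has_real_derivative_ellF_arccos[OF assms(1)]] that assms by simp
    show "isCont (\<lambda>t. 1 / sqrt ((1 - t\<^sup>2) * (1 - \<kappa>\<^sup>2 + \<kappa>\<^sup>2 * t\<^sup>2))) t"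
      if "ereal x < ereal t" "ereal t < ereal 1" for t
      using pos[of t] that by (intro continuous_intros) auto
    show "AE t in lborel. ereal x < ereal t \<longrightarrow> ereal t < ereal 1 \<longrightarrow>
            0 \<le> 1 / sqrt ((1 - t\<^sup>2) * (1 - \<kappa>\<^sup>2 + \<kappa>\<^sup>2 * t\<^sup>2))"
      using pos by (auto simp: less_imp_le)
    have "((\<lambda>t. - ellF \<kappa> (arccos t)) \<longlongrightarrow> - ellF \<kappa> (arccos x)) (at_right x)"
    proof -
      have "at x within {-1..1} = at x" by (rule at_within_interior) (use assms in auto)
      thus ?thesis using lim[of x] assms by (simp add: filterlim_at_split)
    qed
    thus "(((\<lambda>t. - ellF \<kappa> (arccos t)) \<circ> real_of_ereal) \<longlongrightarrow> - ellF \<kappa> (arccos x)) (at_right (ereal x))"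
      by (simp add: ereal_tendsto_simps1)
    have "((\<lambda>t. - ellF \<kappa> (arccos t)) \<longlongrightarrow> - ellF \<kappa> (arccos 1)) (at_left 1)"
      using lim[of 1] by (simp add: at_within_Icc_at_left)
    thus "(((\<lambda>t. - ellF \<kappa> (arccos t)) \<circ> real_of_ereal) \<longlongrightarrow> 0) (at_left (ereal 1))"
      by (simp add: ereal_tendsto_simps1)
  qed
  thus ?thesis by (simp add: cn_inv_def one_ereal_def)
qed

lemma has_real_derivative_cn_inv:
  assumes "\<bar>\<kappa>\<bar> < 1" and "-1 < x" "x < 1"
  shows "(cn_inv \<kappa> has_real_derivative - 1 / sqrt ((1 - x\<^sup>2) * (1 - \<kappa>\<^sup>2 + \<kappa>\<^sup>2 * x\<^sup>2))) (at x)"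
  by (rule has_field_derivative_transform_within_open[OF has_real_derivative_ellF_arccos[OF assms], of "{-1<..<1}"])
     (use assms in \<open>auto simp: cn_inv_eq_ellF_arccos\<close>)

text \<open>The second equation absorbs the undetermined sign in the formula for \<open>f\<close>
  when \<open>g\<close> is expressed through \<open>jacobi_cn\<close>.\<close>

lemma jacobi_cn_cn_inv:
  assumes "\<bar>\<kappa>\<bar> < 1" and "-1 < x" "x < 1"
  shows "jacobi_cn \<kappa> (cn_inv \<kappa> x) = x" and "jacobi_cn \<kappa> (- cn_inv \<kappa> x) = x"
proof -
  show "jacobi_cn \<kappa> (cn_inv \<kappa> x) = x"
    using assms by (simp add: jacobi_cn_def cn_inv_eq_ellF_arccos jacobi_am_ellF)
  show "jacobi_cn \<kappa> (- cn_inv \<kappa> x) = x"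
    using assms by (simp add: jacobi_cn_def cn_inv_eq_ellF_arccos jacobi_am_ellF flip: ellF_minus)
qed

section \<open>The function sd and its principal inverse\<close>

lemma jacobi_sd_ellF:
  assumes "\<bar>\<kappa>\<bar> < 1"
  shows "jacobi_sd \<kappa> (ellF \<kappa> \<phi>) = sin \<phi> / sqrt (1 - \<kappa>\<^sup>2 * (sin \<phi>)\<^sup>2)"
  by (simp add: jacobi_sd_def jacobi_sn_def jacobi_dn_def jacobi_am_ellF[OF assms])

lemma sd_interval_eq:
  assumes "\<bar>\<kappa>\<bar> < 1"
  shows "sd_interval \<kappa> = ellF \<kappa> ` {-(pi/2)..pi/2}"
proof
  show "sd_interval \<kappa> \<subseteq> ellF \<kappa> ` {-(pi/2)..pi/2}"
  proof
    fix w assume "w \<in> sd_interval \<kappa>"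
    hence "ellF \<kappa> (-(pi/2)) \<le> w" "w \<le> ellF \<kappa> (pi/2)"
      by (auto simp: sd_interval_def ellF_minus[OF assms])
    then obtain \<phi> where "-(pi/2) \<le> \<phi>" "\<phi> \<le> pi/2" "ellF \<kappa> \<phi> = w"
      using IVT'[of "ellF \<kappa>" "-(pi/2)" w "pi/2"] continuous_on_ellF[OF assms continuous_on_id]
      by auto
    thus "w \<in> ellF \<kappa> ` {-(pi/2)..pi/2}" by auto
  qed
  show "ellF \<kappa> ` {-(pi/2)..pi/2} \<subseteq> sd_interval \<kappa>"
    using strict_mono_less_eq[OF strict_mono_ellF[OF assms]]
    by (auto simp: sd_interval_def simp flip: ellF_minus[OF assms])
qed

lemma inj_on_jacobi_sd:
  assumes "\<bar>\<kappa>\<bar> < 1"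
  shows "inj_on (jacobi_sd \<kappa>) (sd_interval \<kappa>)"
proof (rule inj_onI)
  fix v w assume "v \<in> sd_interval \<kappa>" "w \<in> sd_interval \<kappa>" and eq: "jacobi_sd \<kappa> v = jacobi_sd \<kappa> w"
  then obtain \<phi> \<psi> where \<phi>: "\<phi> \<in> {-(pi/2)..pi/2}" "v = ellF \<kappa> \<phi>"
    and \<psi>: "\<psi> \<in> {-(pi/2)..pi/2}" "w = ellF \<kappa> \<psi>"
    by (auto simp: sd_interval_eq[OF assms])
  \<comment> \<open>Solving s = sin / dn for the sine: sd determines the sine of the amplitude, and
    the sine is injective on the amplitudes that correspond to \<open>sd_interval\<close>.\<close>
  have sin_eq: "sin \<theta> = s / sqrt (1 + \<kappa>\<^sup>2 * s\<^sup>2)" if "s = sin \<theta> / sqrt (1 - \<kappa>\<^sup>2 * (sin \<theta>)\<^sup>2)" for s \<theta>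
  proof -
    define d where "d = sqrt (1 - \<kappa>\<^sup>2 * (sin \<theta>)\<^sup>2)"
    have d: "d > 0" "d\<^sup>2 = 1 - \<kappa>\<^sup>2 * (sin \<theta>)\<^sup>2"
      using one_minus_sin_pos[OF assms, of \<theta>] by (auto simp: d_def)
    have "1 + \<kappa>\<^sup>2 * s\<^sup>2 = (1 / d)\<^sup>2"
    proof -
      have "s * d = sin \<theta>" using that d(1) unfolding d_def[symmetric] by simp
      hence "(1 + \<kappa>\<^sup>2 * s\<^sup>2) * d\<^sup>2 = d\<^sup>2 + \<kappa>\<^sup>2 * (sin \<theta>)\<^sup>2"
        by (simp add: distrib_right mult.assoc power_mult_distrib flip: \<open>s * d = sin \<theta>\<close>)
      also have "\<dots> = 1" using d(2) by simp
      finally show ?thesis using d(1) by (simp add: power_divide nonzero_eq_divide_eq)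
    qed
    hence "sqrt (1 + \<kappa>\<^sup>2 * s\<^sup>2) = 1 / d" using d by simp
    thus ?thesis using that d unfolding d_def[symmetric] by simp
  qed
  define s where "s = jacobi_sd \<kappa> v"
  have "s = sin \<phi> / sqrt (1 - \<kappa>\<^sup>2 * (sin \<phi>)\<^sup>2)"
    unfolding s_def \<phi>(2) by (rule jacobi_sd_ellF[OF assms])
  moreover have "s = sin \<psi> / sqrt (1 - \<kappa>\<^sup>2 * (sin \<psi>)\<^sup>2)"
    unfolding s_def eq \<psi>(2) by (rule jacobi_sd_ellF[OF assms])
  ultimately have "sin \<phi> = sin \<psi>"
    by (rule sin_eq[THEN trans, OF _ sin_eq[symmetric]])
  hence "\<phi> = \<psi>" using \<phi>(1) \<psi>(1) sin_inj_pi[of \<phi> \<psi>] by auto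
  thus "v = w" using \<phi> \<psi> by simp
qed

text \<open>The amplitude comes from sin = s / sqrt (1 + \<kappa>^2 s^2), the inverse of s = sin /
  dn, at s = x / \<kappa>' with \<kappa>' = sqrt (1 - \<kappa>^2). Since x < 1, this sine is below
  1, so \<open>arcsin\<close> gives a point of the principal interval.\<close>

lemma
  assumes "0 < \<kappa>" "\<kappa> < 1" and "0 < x" "x < 1"
  shows jacobi_sd_image: "x / sqrt (1 - \<kappa>\<^sup>2) \<in> jacobi_sd \<kappa> ` sd_interval \<kappa>"
    and sd_inv_eq_ellF_arcsin:
      "sd_inv \<kappa> (x / sqrt (1 - \<kappa>\<^sup>2)) = ellF \<kappa> (arcsin (x / sqrt (1 - \<kappa>\<^sup>2 + \<kappa>\<^sup>2 * x\<^sup>2)))"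
proof -
  define t where "t = x / sqrt (1 - \<kappa>\<^sup>2 + \<kappa>\<^sup>2 * x\<^sup>2)"
  have \<kappa>: "\<bar>\<kappa>\<bar> < 1" "\<kappa>\<^sup>2 < 1" using assms by (auto simp: abs_square_less_1)
  have x: "x\<^sup>2 < 1" using assms by (auto simp: abs_square_less_1)
  have pos: "0 < 1 - \<kappa>\<^sup>2 + \<kappa>\<^sup>2 * x\<^sup>2" using \<kappa> by (intro add_pos_nonneg) auto
  have t2: "t\<^sup>2 = x\<^sup>2 / (1 - \<kappa>\<^sup>2 + \<kappa>\<^sup>2 * x\<^sup>2)" using pos by (simp add: t_def power_divide)
  have "0 < (1 - \<kappa>\<^sup>2) * (1 - x\<^sup>2)" using \<kappa> x by simp
  hence "t\<^sup>2 < 1" using pos by (simp add: t2 field_simps)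
  hence t1: "-1 < t" "t < 1" by (auto simp: abs_square_less_1)
  have "1 - \<kappa>\<^sup>2 * t\<^sup>2 = (1 - \<kappa>\<^sup>2) / (1 - \<kappa>\<^sup>2 + \<kappa>\<^sup>2 * x\<^sup>2)"
    using pos by (simp add: t2 field_simps)
  hence sd: "jacobi_sd \<kappa> (ellF \<kappa> (arcsin t)) = x / sqrt (1 - \<kappa>\<^sup>2)"
    using pos \<kappa> t1 by (simp add: jacobi_sd_ellF real_sqrt_divide) (simp add: t_def)
  have mem: "ellF \<kappa> (arcsin t) \<in> sd_interval \<kappa>"
    unfolding sd_interval_eq[OF \<kappa>(1)] using arcsin_bounded[of t] t1 by auto
  show "x / sqrt (1 - \<kappa>\<^sup>2) \<in> jacobi_sd \<kappa> ` sd_interval \<kappa>"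
    using imageI[OF mem, of "jacobi_sd \<kappa>"] by (simp only: sd)
  show "sd_inv \<kappa> (x / sqrt (1 - \<kappa>\<^sup>2)) = ellF \<kappa> (arcsin (x / sqrt (1 - \<kappa>\<^sup>2 + \<kappa>\<^sup>2 * x\<^sup>2)))"
    unfolding sd_inv_def using the_inv_into_f_f[OF inj_on_jacobi_sd[OF \<kappa>(1)] mem] sd
    by (simp add: t_def)
qed

text \<open>The reflection \<open>sd (K - w) = cn w / \<kappa>'\<close>, proved by differentiating its inverted form.\<close>

lemma sd_inv_plus_cn_inv:
  assumes "0 < \<kappa>" "\<kappa> < 1"
  obtains c where "\<And>x. 0 < x \<Longrightarrow> x < 1 \<Longrightarrow> sd_inv \<kappa> (x / sqrt (1 - \<kappa>\<^sup>2)) = c - cn_inv \<kappa> x"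
proof -
  have \<kappa>: "\<bar>\<kappa>\<bar> < 1" "\<kappa>\<^sup>2 < 1" using assms by (auto simp: abs_square_less_1)
  define p where "p = (\<lambda>x. 1 - \<kappa>\<^sup>2 + \<kappa>\<^sup>2 * x\<^sup>2)"
  have "((\<lambda>x. ellF \<kappa> (arcsin (x / sqrt (p x))) + cn_inv \<kappa> x) has_real_derivative 0) (at x within {0<..<1})"
    if x: "0 < x" "x < 1" for x
  proof -
    have x2: "x\<^sup>2 < 1" using x by (auto simp: abs_square_less_1)
    have pos: "0 < p x" unfolding p_def using \<kappa> by (intro add_pos_nonneg) auto
    define t where "t = x / sqrt (p x)"
    have t2: "t\<^sup>2 = x\<^sup>2 / p x" using pos by (simp add: t_def power_divide)
    have dt: "((\<lambda>x. x / sqrt (p x)) has_real_derivative (1 - \<kappa>\<^sup>2) / (p x * sqrt (p x))) (at x)"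
    proof -
      have dp: "(p has_real_derivative 2 * \<kappa>\<^sup>2 * x) (at x)"
        unfolding p_def by (auto intro!: derivative_eq_intros)
      have "((\<lambda>x. x / sqrt (p x)) has_real_derivative
              (1 * sqrt (p x) - x * (inverse (sqrt (p x)) / 2 * (2 * \<kappa>\<^sup>2 * x))) / (sqrt (p x) * sqrt (p x))) (at x)"
        using pos by (intro DERIV_divide DERIV_ident DERIV_chain2[OF DERIV_real_sqrt dp]) auto
      also have "(1 * sqrt (p x) - x * (inverse (sqrt (p x)) / 2 * (2 * \<kappa>\<^sup>2 * x))) / (sqrt (p x) * sqrt (p x))
          = (1 - \<kappa>\<^sup>2) / (p x * sqrt (p x))"
      proof -
        define s where "s = sqrt (p x)"
        have s: "s > 0" "p x = s * s" using pos by (auto simp: s_def)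
        have "s * s - \<kappa>\<^sup>2 * x\<^sup>2 = 1 - \<kappa>\<^sup>2" using s(2) unfolding p_def by linarith
        moreover have "(1 * s - x * (inverse s / 2 * (2 * \<kappa>\<^sup>2 * x))) / (s * s)
            = (s * s - \<kappa>\<^sup>2 * x\<^sup>2) / (s * s * s)"
        proof -
          have "1 * s - x * (inverse s / 2 * (2 * \<kappa>\<^sup>2 * x)) = (s * s - \<kappa>\<^sup>2 * x\<^sup>2) / s"
            using s(1) by (simp add: diff_divide_distrib power2_eq_square inverse_eq_divide)
          thus ?thesis by (simp only: divide_divide_eq_left mult.assoc)
        qed
        ultimately show ?thesis unfolding s_def[symmetric] by (simp only: s(2))
      qed
      finally show ?thesis .
    qed
    have e1: "1 - t\<^sup>2 = (1 - \<kappa>\<^sup>2) * (1 - x\<^sup>2) / p x"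
    proof -
      have "1 - t\<^sup>2 = (p x - x\<^sup>2) / p x" unfolding t2 using pos by (simp add: diff_divide_distrib)
      also have "p x - x\<^sup>2 = (1 - \<kappa>\<^sup>2) * (1 - x\<^sup>2)" by (simp add: p_def algebra_simps)
      finally show ?thesis .
    qed
    have e2: "1 - \<kappa>\<^sup>2 * t\<^sup>2 = (1 - \<kappa>\<^sup>2) / p x"
    proof -
      have "1 - \<kappa>\<^sup>2 * t\<^sup>2 = (p x - \<kappa>\<^sup>2 * x\<^sup>2) / p x" unfolding t2 using pos by (simp add: diff_divide_distrib)
      thus ?thesis by (simp add: p_def)
    qed
    have "0 < 1 - t\<^sup>2" unfolding e1 using pos \<kappa> x2 by simp
    hence t1: "-1 < t" "t < 1" by (auto simp: abs_square_less_1)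
    have "((\<lambda>x. ellF \<kappa> (arcsin (x / sqrt (p x))) + cn_inv \<kappa> x) has_real_derivative
        1 / sqrt (1 - \<kappa>\<^sup>2 * (sin (arcsin t))\<^sup>2) * (inverse (sqrt (1 - t\<^sup>2)) * ((1 - \<kappa>\<^sup>2) / (p x * sqrt (p x))))
        + - 1 / sqrt ((1 - x\<^sup>2) * (1 - \<kappa>\<^sup>2 + \<kappa>\<^sup>2 * x\<^sup>2))) (at x)"
      using t1 x unfolding t_def
      by (intro DERIV_add DERIV_chain2[OF has_real_derivative_ellF] DERIV_chain2[OF DERIV_arcsin] dt
            has_real_derivative_cn_inv \<kappa>) auto
    also have "1 / sqrt (1 - \<kappa>\<^sup>2 * (sin (arcsin t))\<^sup>2) * (inverse (sqrt (1 - t\<^sup>2)) * ((1 - \<kappa>\<^sup>2) / (p x * sqrt (p x))))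
        + - 1 / sqrt ((1 - x\<^sup>2) * (1 - \<kappa>\<^sup>2 + \<kappa>\<^sup>2 * x\<^sup>2)) = 0"
    proof -
      \<comment> \<open>At the amplitude \<open>arcsin t\<close>, dn is a / b and cn is a d / b; the
        two summands of the derivative are then 1 / (d b) and its negative.\<close>
      define a b d where "a = sqrt (1 - \<kappa>\<^sup>2)" and "b = sqrt (p x)" and "d = sqrt (1 - x\<^sup>2)"
      have abd: "a > 0" "b > 0" "d > 0" using \<kappa> pos x2 by (auto simp: a_def b_def d_def)
      have sq: "1 - \<kappa>\<^sup>2 = a\<^sup>2" "p x = b\<^sup>2" using \<kappa> pos by (auto simp: a_def b_def)
      have "sqrt (1 - \<kappa>\<^sup>2 * (sin (arcsin t))\<^sup>2) = a / b" "sqrt (1 - t\<^sup>2) = a * d / b"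
        "sqrt ((1 - x\<^sup>2) * (1 - \<kappa>\<^sup>2 + \<kappa>\<^sup>2 * x\<^sup>2)) = d * b"
        using t1 by (simp_all add: e1 e2 real_sqrt_divide real_sqrt_mult a_def b_def d_def)
           (simp add: p_def)
      moreover have "1 / (a / b) * (inverse (a * d / b) * (a\<^sup>2 / (b\<^sup>2 * b))) + - 1 / (d * b) = 0"
        using abd by (simp add: power2_eq_square inverse_eq_divide)
      ultimately show ?thesis unfolding b_def[symmetric] by (simp only: sq)
    qed
    finally show ?thesis by (rule has_field_derivative_at_within)
  qed
  \<comment> \<open>Letting x tend to 0 would identify the constant as the quarter period. Only its
    existence matters, since it is absorbed into the additive constant \<open>D\<close>.\<close>
  then obtain c where c: "\<forall>x\<in>{0<..<1}. ellF \<kappa> (arcsin (x / sqrt (p x))) + cn_inv \<kappa> x = c"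
    using has_field_derivative_zero_constant[of "{0<..<1::real}" "\<lambda>x. ellF \<kappa> (arcsin (x / sqrt (p x))) + cn_inv \<kappa> x"]
    by auto
  show thesis
  proof
    fix x :: real assume "0 < x" "x < 1"
    moreover from this have "ellF \<kappa> (arcsin (x / sqrt (p x))) + cn_inv \<kappa> x = c"
      using c by (meson greaterThanLessThan_iff)
    ultimately show "sd_inv \<kappa> (x / sqrt (1 - \<kappa>\<^sup>2)) = c - cn_inv \<kappa> x"
      using sd_inv_eq_ellF_arcsin[OF assms, of x] unfolding p_def by linarith
  qed
qed

section \<open>The representation of solutions of the profile equation\<close>

lemma has_real_derivative_zero_constant_on_connected:
  fixes F :: "real \<Rightarrow> real"
  assumes "connected I" and "\<And>s. s \<in> I \<Longrightarrow> (F has_real_derivative 0) (at s)"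
  obtains c where "\<And>s. s \<in> I \<Longrightarrow> F s = c"
proof -
  have "convex I" using assms(1) by (simp add: connected_convex_1)
  with assms(2) show thesis
    using has_field_derivative_zero_constant[of I F] has_field_derivative_at_within that by meson
qed

lemma constant_sign_on_connected:
  fixes F :: "real \<Rightarrow> real"
  assumes "connected I" and "continuous_on I F" and "\<And>s. s \<in> I \<Longrightarrow> F s \<noteq> 0"
  obtains \<epsilon> where "\<epsilon> \<in> {1, -1 :: real}" and "\<And>s. s \<in> I \<Longrightarrow> sgn (F s) = \<epsilon>"
proof -
  have conn: "connected (F ` I)" using assms by (simp add: connected_continuous_image)
  have "(\<forall>s\<in>I. F s > 0) \<or> (\<forall>s\<in>I. F s < 0)"
  proof (rule ccontr)
    assume "\<not> ?thesis"
    then obtain s t where "s \<in> I" "F s < 0" "t \<in> I" "F t > 0"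
      using assms(3) by (meson linorder_neqE_linordered_idom)
    hence "0 \<in> F ` I" using connectedD_interval[OF conn, of "F s" "F t" 0] by simp
    thus False using assms(3) by auto
  qed
  thus thesis
  proof
    assume "\<forall>s\<in>I. F s > 0" thus thesis using that[of 1] by simp
  next
    assume "\<forall>s\<in>I. F s < 0" thus thesis using that[of "-1"] by simp
  qed
qed

lemma has_real_derivative_abs:
  assumes "x \<noteq> 0"
  shows "(abs has_real_derivative sgn x) (at (x :: real))"
  using has_derivative_norm[OF assms]
  by (simp add: has_field_derivative_def real_norm_def[abs_def] mult.commute[of _ "sgn x"])

text \<open>Separation of variables for one modulus. \<open>G\<close> is left general so that the
  identity gives the formula for \<open>f\<close> and \<open>G = g\<close> the one for
  \<open>g \<circ> f\<close>, both with the same \<open>K\<close>. With \<open>X\<close> the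
  rescaled \<open>\<bar>sinh K\<bar>\<close>, the hypothesis says that the derivative of
  \<open>cn_inv \<kappa> (X s)\<close> is a constant multiple of \<open>G1\<close>, up to a
  sign.\<close>

lemma cn_inv_of_profile:
  fixes K K1 G G1 :: "real \<Rightarrow> real"
  assumes I: "connected I" and \<kappa>: "0 < \<kappa>" "\<kappa> < 1" and c: "0 < c"
    and K: "\<And>s. s \<in> I \<Longrightarrow> (K has_real_derivative K1 s) (at s)"
    and G: "\<And>s. s \<in> I \<Longrightarrow> (G has_real_derivative G1 s) (at s)"
    and cont: "continuous_on I K1" "continuous_on I G1"
    and nz: "\<And>s. s \<in> I \<Longrightarrow> K s \<noteq> 0" "\<And>s. s \<in> I \<Longrightarrow> K1 s \<noteq> 0" "\<And>s. s \<in> I \<Longrightarrow> G1 s \<noteq> 0"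
    and eq: "\<And>s. s \<in> I \<Longrightarrow> (K1 s)\<^sup>2 = (G1 s)\<^sup>2 * (c\<^sup>2 * (\<kappa>\<^sup>2 / (1 - \<kappa>\<^sup>2) - (sinh (K s))\<^sup>2))"
  defines "X \<equiv> \<lambda>s. sqrt (1 - \<kappa>\<^sup>2) / \<kappa> * \<bar>sinh (K s)\<bar>"
  obtains \<sigma> C where "\<sigma> \<in> {1, -1}"
    and "\<And>s. s \<in> I \<Longrightarrow> X s \<in> {0<..<1}"
    and "\<And>s. s \<in> I \<Longrightarrow> G s = \<sigma> * sqrt (1 - \<kappa>\<^sup>2) / c * cn_inv \<kappa> (X s) + C"
proof -
  define k' where "k' = sqrt (1 - \<kappa>\<^sup>2)"
  have \<kappa>2: "\<bar>\<kappa>\<bar> < 1" "\<kappa>\<^sup>2 < 1" using \<kappa> by (auto simp: abs_square_less_1)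
  have k': "k' > 0" "k'\<^sup>2 = 1 - \<kappa>\<^sup>2" using \<kappa>2 by (auto simp: k'_def)
  have X2: "(sinh (K s))\<^sup>2 = \<kappa>\<^sup>2 / k'\<^sup>2 * (X s)\<^sup>2" for s
    using k'(1) \<kappa> unfolding X_def k'_def[symmetric] by (simp add: power_mult_distrib power_divide)
  have eqX: "(K1 s)\<^sup>2 = (G1 s)\<^sup>2 * c\<^sup>2 * \<kappa>\<^sup>2 / k'\<^sup>2 * (1 - (X s)\<^sup>2)" if "s \<in> I" for s
    unfolding eq[OF that] X2 k'(2)[symmetric] by (simp add: right_diff_distrib)
  \<comment> \<open>A nonzero \<open>K1\<close> keeps \<open>X\<close> strictly below 1, away from
    the singular endpoint of \<open>cn_inv\<close>; a nonzero \<open>K\<close> keeps it above 0,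
    where the absolute value is differentiable.\<close>
  have X01: "X s \<in> {0<..<1}" if s: "s \<in> I" for s
  proof -
    have "0 < (K1 s)\<^sup>2" using nz(2)[OF s] by simp
    hence "0 < ((G1 s)\<^sup>2 * c\<^sup>2 * \<kappa>\<^sup>2 / k'\<^sup>2) * (1 - (X s)\<^sup>2)" by (simp only: eqX[OF s])
    moreover have "0 < (G1 s)\<^sup>2 * c\<^sup>2 * \<kappa>\<^sup>2 / k'\<^sup>2" using nz(3)[OF s] c \<kappa> k'(1) by simp
    ultimately have "0 < 1 - (X s)\<^sup>2" by (simp only: zero_less_mult_pos)
    hence "X s < 1" by (auto simp: abs_square_less_1)
    moreover have "0 < X s" using nz(1)[OF s] k' \<kappa> unfolding X_def k'_def[symmetric] by simp
    ultimately show ?thesis by simp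
  qed
  have contK: "continuous_on I K"
    using K by (meson DERIV_continuous_on has_field_derivative_at_within)
  have cont3: "continuous_on I (\<lambda>s. K s * K1 s * G1 s)"
    by (intro continuous_intros cont contK)
  have nz3: "K s * K1 s * G1 s \<noteq> 0" if "s \<in> I" for s using nz[OF that] by simp
  \<comment> \<open>Three signs enter the derivative: that of \<open>K\<close> from the absolute
    value, those of \<open>K1\<close> and \<open>G1\<close> from extracting the square root of
    \<open>eq\<close>. Only their product matters, and it is constant on the interval.\<close>
  obtain \<epsilon> where \<epsilon>: "\<epsilon> \<in> {1, -1}" "\<And>s. s \<in> I \<Longrightarrow> sgn (K s * K1 s * G1 s) = \<epsilon>"
    using constant_sign_on_connected[OF I cont3 nz3] by metis
  have D: "((\<lambda>s. cn_inv \<kappa> (X s)) has_real_derivative - (\<epsilon> * c / k' * G1 s)) (at s)" if s: "s \<in> I" for s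
  proof -
    define d where "d = sqrt (1 - (X s)\<^sup>2)"
    have X: "0 < X s" "X s < 1" using X01[OF s] by auto
    have d: "d > 0" "d\<^sup>2 = 1 - (X s)\<^sup>2" using X by (auto simp: d_def abs_square_less_1 power_le_one)
    have "sinh (K s) \<noteq> 0" using nz(1)[OF s] by simp
    hence "((\<lambda>s. \<bar>sinh (K s)\<bar>) has_real_derivative sgn (sinh (K s)) * (cosh (K s) * K1 s)) (at s)"
      by (rule DERIV_chain2[OF has_real_derivative_abs has_field_derivative_sinh[OF K[OF s]]])
    moreover have "sgn (sinh (K s)) = sgn (K s)" by (auto simp: sgn_if)
    ultimately have "((\<lambda>s. k' / \<kappa> * \<bar>sinh (K s)\<bar>) has_real_derivative
        k' / \<kappa> * (sgn (K s) * (cosh (K s) * K1 s))) (at s)"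
      using DERIV_cmult by metis
    hence DX: "(X has_real_derivative k' / \<kappa> * (sgn (K s) * (cosh (K s) * K1 s))) (at s)"
      unfolding X_def k'_def .
    \<comment> \<open>The second factor of the elliptic integrand is a multiple of cosh K, which
      cancels the cosh K produced by differentiating sinh K. What remains is \<open>K1\<close> over
      \<open>d\<close>, and \<open>eq\<close> turns that into \<open>G1\<close>.\<close>
    have "1 - \<kappa>\<^sup>2 + \<kappa>\<^sup>2 * (X s)\<^sup>2 = k'\<^sup>2 * (1 + (sinh (K s))\<^sup>2)"
      unfolding X2 using k'(1) by (simp add: k'(2)[symmetric] distrib_left)
    also have "\<dots> = (k' * cosh (K s))\<^sup>2"
      by (simp add: cosh_square_eq power_mult_distrib)
    finally have "sqrt ((1 - (X s)\<^sup>2) * (1 - \<kappa>\<^sup>2 + \<kappa>\<^sup>2 * (X s)\<^sup>2)) = d * (k' * cosh (K s))"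
      using k'(1) by (simp add: real_sqrt_mult d_def)
    with DERIV_chain2[OF has_real_derivative_cn_inv[OF \<kappa>2(1)] DX] X
    have D1: "((\<lambda>s. cn_inv \<kappa> (X s)) has_real_derivative
        - 1 / (d * (k' * cosh (K s))) * (k' / \<kappa> * (sgn (K s) * (cosh (K s) * K1 s)))) (at s)"
      by simp
    have sq: "(K1 s)\<^sup>2 = (G1 s * c * \<kappa> / k' * d)\<^sup>2"
      unfolding eqX[OF s] using d by (simp add: power_mult_distrib power_divide)
    have "\<bar>K1 s\<bar> = \<bar>G1 s\<bar> * c * \<kappa> / k' * d"
    proof -
      have "\<bar>K1 s\<bar> = \<bar>G1 s * c * \<kappa> / k' * d\<bar>"
        using sq by (simp only: power2_eq_iff abs_eq_iff)
      thus ?thesis using c \<kappa> k'(1) d(1) by (simp add: abs_mult)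
    qed
    hence K1: "K1 s = sgn (K1 s) * (\<bar>G1 s\<bar> * c * \<kappa> / k' * d)" by (metis sgn_mult_abs)
    have "- 1 / (d * (k' * cosh (K s))) * (k' / \<kappa> * (sgn (K s) * (cosh (K s) * K1 s)))
        = - (sgn (K s) * K1 s / (d * \<kappa>))"
      using k' by simp
    also have "\<dots> = - (sgn (K s) * sgn (K1 s) * \<bar>G1 s\<bar> * c / k')"
      by (subst K1) (use d \<kappa> in simp)
    also have "\<bar>G1 s\<bar> = sgn (G1 s) * G1 s" by (simp add: sgn_if)
    also have "- (sgn (K s) * sgn (K1 s) * (sgn (G1 s) * G1 s) * c / k') = - (\<epsilon> * c / k' * G1 s)"
      using \<epsilon>(2)[OF s] by (simp add: sgn_mult)
    finally show ?thesis using D1 by simp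
  qed
  have \<epsilon>2: "\<epsilon> * \<epsilon> = 1" using \<epsilon>(1) by auto
  have "((\<lambda>s. G s + \<epsilon> * k' / c * cn_inv \<kappa> (X s)) has_real_derivative 0) (at s)" if "s \<in> I" for s
  proof -
    have "\<epsilon> * k' / c * - (\<epsilon> * c / k' * G1 s) = - (\<epsilon> * \<epsilon> * G1 s)" using c k' by simp
    with DERIV_add[OF G[OF that] DERIV_cmult[OF D[OF that], of "\<epsilon> * k' / c"]] \<epsilon>2
    show ?thesis by simp
  qed
  then obtain C where C: "\<And>s. s \<in> I \<Longrightarrow> G s + \<epsilon> * k' / c * cn_inv \<kappa> (X s) = C"
    using has_real_derivative_zero_constant_on_connected[OF I] by meson
  show thesis
  proof (rule that)
    show "- \<epsilon> \<in> {1, -1}" using \<epsilon>(1) by auto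
    show "X s \<in> {0<..<1}" if "s \<in> I" for s by (rule X01[OF that])
    show "G s = - \<epsilon> * sqrt (1 - \<kappa>\<^sup>2) / c * cn_inv \<kappa> (X s) + C" if "s \<in> I" for s
      using C[OF that] by (simp add: k'_def)
  qed
qed

text \<open>All arguments in the three formulas are multiples of the single function
  \<open>\<bar>sinh (K s)\<bar>\<close>. Solving the two first-order equations gives both cn
  formulas; eliminating the common function between them, with the reflection from cn to sd, gives
  the formula for \<open>g\<close>.\<close>

lemma elliptic_representation_of_profile:
  assumes \<Omega>: "connected \<Omega>" "continuous_on \<Omega> f" and gf: "minimal_graph_surface \<Omega> (g \<circ> f)"
    and \<gamma>: "0 < \<gamma>" "\<gamma> < 1" and \<Lambda>: "0 < \<Lambda>" "\<Lambda> < 1" and c0: "c0 \<noteq> 0"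
    and tanh: "\<And>z. z \<in> \<Omega> \<Longrightarrow> tanh (r * (z + c1) / 2) \<noteq> 0"
    and Kf: "\<And>z. z \<in> \<Omega> \<Longrightarrow> K (f z) = ln (cmod (tanh (r * (z + c1) / 2)))"
    and K: "\<And>s. s \<in> f ` \<Omega> \<Longrightarrow> (K has_real_derivative K1 s) (at s)"
    and g: "\<And>s. s \<in> f ` \<Omega> \<Longrightarrow> (g has_real_derivative g1 s) (at s)"
    and cont: "continuous_on (f ` \<Omega>) K1" "continuous_on (f ` \<Omega>) g1"
    and nz: "\<And>s. s \<in> f ` \<Omega> \<Longrightarrow> K s \<noteq> 0" "\<And>s. s \<in> f ` \<Omega> \<Longrightarrow> K1 s \<noteq> 0"
      "\<And>s. s \<in> f ` \<Omega> \<Longrightarrow> g1 s \<noteq> 0"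
    and eq\<gamma>: "\<And>s. s \<in> f ` \<Omega> \<Longrightarrow> (K1 s)\<^sup>2 = cmod c0 * (\<gamma>\<^sup>2 / (1 - \<gamma>\<^sup>2) - (sinh (K s))\<^sup>2)"
    and eq\<Lambda>: "\<And>s. s \<in> f ` \<Omega> \<Longrightarrow>
          (K1 s)\<^sup>2 = (g1 s)\<^sup>2 * (cmod c0 * (\<Lambda>\<^sup>2 / (1 - \<Lambda>\<^sup>2) - (sinh (K s))\<^sup>2))"
  shows "elliptic_representation \<Omega> f g c0 r \<gamma> \<Lambda>"
proof -
  define I where "I = f ` \<Omega>"
  define c where "c = sqrt (cmod c0)"
  define X where "X = (\<lambda>\<kappa> s. sqrt (1 - \<kappa>\<^sup>2) / \<kappa> * \<bar>sinh (K s)\<bar>)"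
  have I: "connected I" unfolding I_def using \<Omega> by (simp add: connected_continuous_image)
  have c: "c > 0" "cmod c0 = c\<^sup>2" using c0 by (auto simp: c_def)
  have \<gamma>': "sqrt (1 - \<gamma>\<^sup>2) > 0" and \<Lambda>': "sqrt (1 - \<Lambda>\<^sup>2) > 0"
    using \<gamma> \<Lambda> by (auto simp: abs_square_less_1)
  note K' = K[folded I_def] and g' = g[folded I_def] and cont' = cont[folded I_def]
    and nz' = nz[folded I_def] and eq' = eq\<gamma>[folded I_def, unfolded c] eq\<Lambda>[folded I_def, unfolded c]
  obtain \<sigma>1 C where \<sigma>1: "\<sigma>1 \<in> {1, -1}" and X\<gamma>: "\<And>s. s \<in> I \<Longrightarrow> X \<gamma> s \<in> {0<..<1}"
    and f_eq: "\<And>s. s \<in> I \<Longrightarrow> s = \<sigma>1 * sqrt (1 - \<gamma>\<^sup>2) / c * cn_inv \<gamma> (X \<gamma> s) + C"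
    unfolding X_def
    by (rule cn_inv_of_profile[OF I \<gamma> c(1) K', of "\<lambda>s. s" "\<lambda>_. 1"])
       (use cont' nz' eq' in \<open>auto\<close>)
  obtain \<sigma>3 C4 where \<sigma>3: "\<sigma>3 \<in> {1, -1}" and X\<Lambda>: "\<And>s. s \<in> I \<Longrightarrow> X \<Lambda> s \<in> {0<..<1}"
    and g_eq: "\<And>s. s \<in> I \<Longrightarrow> g s = \<sigma>3 * sqrt (1 - \<Lambda>\<^sup>2) / c * cn_inv \<Lambda> (X \<Lambda> s) + C4"
    unfolding X_def
    by (rule cn_inv_of_profile[OF I \<Lambda> c(1) K' g' cont' nz' eq'(2)]) auto
  obtain S where S: "\<And>x. 0 < x \<Longrightarrow> x < 1 \<Longrightarrow> sd_inv \<Lambda> (x / sqrt (1 - \<Lambda>\<^sup>2)) = S - cn_inv \<Lambda> x"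
    using sd_inv_plus_cn_inv[OF \<Lambda>] by metis
  have arg: "cn_argument r c1 \<kappa> z = X \<kappa> (f z)" if "z \<in> \<Omega>" for \<kappa> z
  proof -
    have "cosh (2 * t) - 1 = 2 * (sinh t)\<^sup>2" for t :: real
      by (simp add: cosh_double cosh_square_eq)
    thus ?thesis by (simp add: cn_argument_def X_def Kf[OF that])
  qed
  have graph\<gamma>: "cn_graph \<Omega> c0 r c1 \<gamma> \<sigma>1 (- (- C)) f"
    unfolding cn_graph_def
  proof (intro ballI conjI)
    fix z assume z: "z \<in> \<Omega>"
    hence fz: "f z \<in> I" by (simp add: I_def)
    show "tanh (r * (z + c1) / 2) \<noteq> 0" by (rule tanh[OF z])
    show "cn_argument r c1 \<gamma> z \<in> {-1..1}" unfolding arg[OF z] using X\<gamma>[OF fz] by auto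
    show "f z = \<sigma>1 * sqrt (1 - \<gamma>\<^sup>2) / sqrt (cmod c0) * cn_inv \<gamma> (cn_argument r c1 \<gamma> z) + - (- C)"
      unfolding arg[OF z] c_def[symmetric] using f_eq[OF fz] by simp
  qed
  have graph\<Lambda>: "cn_graph \<Omega> c0 r c1 \<Lambda> \<sigma>3 C4 (g \<circ> f)"
    unfolding cn_graph_def
  proof (intro ballI conjI)
    fix z assume z: "z \<in> \<Omega>"
    hence fz: "f z \<in> I" by (simp add: I_def)
    show "tanh (r * (z + c1) / 2) \<noteq> 0" by (rule tanh[OF z])
    show "cn_argument r c1 \<Lambda> z \<in> {-1..1}" unfolding arg[OF z] using X\<Lambda>[OF fz] by auto
    show "(g \<circ> f) z = \<sigma>3 * sqrt (1 - \<Lambda>\<^sup>2) / sqrt (cmod c0) * cn_inv \<Lambda> (cn_argument r c1 \<Lambda> z) + C4"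
      unfolding arg[OF z] c_def[symmetric] using g_eq[OF fz] by simp
  qed
  \<comment> \<open>Substituting \<open>cn_inv = S - sd_inv\<close> into the formula for
    \<open>g\<close> reverses the sign \<open>\<sigma>3\<close> and moves the multiple of
    \<open>S\<close> into \<open>D\<close>.\<close>
  have sd: "sd_transformation (f ` \<Omega>) c0 \<gamma> \<Lambda> (- C) (- \<sigma>3) (\<sigma>3 * sqrt (1 - \<Lambda>\<^sup>2) / c * S + C4) g"
    unfolding sd_transformation_def I_def[symmetric]
  proof (intro ballI conjI)
    fix s assume s: "s \<in> I"
    have "c / sqrt (1 - \<gamma>\<^sup>2) * (s + - C) = \<sigma>1 * cn_inv \<gamma> (X \<gamma> s)"
      using f_eq[OF s] c \<gamma>' by (simp add: field_simps)
    hence "jacobi_cn \<gamma> (c / sqrt (1 - \<gamma>\<^sup>2) * (s + - C)) = X \<gamma> s"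
      using \<sigma>1 X\<gamma>[OF s] jacobi_cn_cn_inv[of \<gamma> "X \<gamma> s"] \<gamma> by auto
    \<comment> \<open>The factor \<gamma> / (\<gamma>' \<Lambda>) in the definition exchanges the
      normalisations: it turns \<open>X \<gamma> s\<close> into \<open>X \<Lambda> s\<close> over
      \<Lambda>'.\<close>
    hence A: "sd_argument c0 \<gamma> \<Lambda> (- C) s = X \<Lambda> s / sqrt (1 - \<Lambda>\<^sup>2)"
      unfolding sd_argument_def c_def[symmetric] using \<gamma> \<gamma>' \<Lambda> \<Lambda>' by (simp add: X_def)
    have X: "0 < X \<Lambda> s" "X \<Lambda> s < 1" using X\<Lambda>[OF s] by auto
    show "sd_argument c0 \<gamma> \<Lambda> (- C) s \<in> jacobi_sd \<Lambda> ` sd_interval \<Lambda>"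
      unfolding A by (rule jacobi_sd_image[OF \<Lambda> X])
    show "g s = - \<sigma>3 * sqrt (1 - \<Lambda>\<^sup>2) / sqrt (cmod c0) * sd_inv \<Lambda> (sd_argument c0 \<gamma> \<Lambda> (- C) s)
            + (\<sigma>3 * sqrt (1 - \<Lambda>\<^sup>2) / c * S + C4)"
      unfolding A S[OF X] c_def[symmetric] using g_eq[OF s] by (simp add: algebra_simps diff_divide_distrib)
  qed
  have "- \<sigma>3 \<in> {1, -1}" using \<sigma>3 by auto
  with \<sigma>1 \<sigma>3 graph\<gamma> sd gf graph\<Lambda> show ?thesis
    unfolding elliptic_representation_def by blast
qed

section \<open>Minimal graphs whose level sets are those of a harmonic function\<close>

lemma pd_eqI:
  assumes "(f has_derivative D) (at z)"
  shows "pd v f z = D v"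
  using frechet_derivative_at[OF assms] by (simp add: pd_def)

lemma smooth_plane_differentiable:
  assumes "smooth_plane \<Omega> f" "open \<Omega>" "z \<in> \<Omega>"
  shows "f differentiable at z" "dx f differentiable at z" "dy f differentiable at z"
proof -
  have *: "foldr pd vs f differentiable at z" if "set vs \<subseteq> {1, \<i>}" for vs
    using assms that by (force simp: smooth_plane_def differentiable_on_def dest: at_within_open)
  show "f differentiable at z" using *[of "[]"] by simp
  show "dx f differentiable at z" using *[of "[1]"] by simp
  show "dy f differentiable at z" using *[of "[\<i>]"] by simp
qed

lemma has_derivative_Re_holomorphic:
  assumes "(q has_field_derivative q') (at z)"
  shows "((\<lambda>z. Re (q z)) has_derivative (\<lambda>h. Re (q' * h))) (at z)"
  using has_derivative_Re[OF assms[unfolded has_field_derivative_def]] by simp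

text \<open>The harmonic function is \<open>K \<circ> f\<close>, with complex gradient \<open>q\<close>. In terms of \<open>K\<close> and \<open>q\<close> the
  Laplacian of \<open>f\<close> is \<open>- K'' \<bar>q\<bar>\<^sup>2 / K'\<^sup>3\<close>, and the cubic part of the minimal surface operator, which
  only sees the level sets, is \<open>- Re (q\<^sup>2 cnj q') / K'\<^sup>3\<close>.\<close>

lemma minimal_surface_equation_iff:
  fixes K K1 K2 :: "real \<Rightarrow> real"
  assumes \<Omega>: "open \<Omega>" "z \<in> \<Omega>" and smooth: "smooth_plane \<Omega> f" and q: "q holomorphic_on \<Omega>"
    and Kf: "\<And>z. z \<in> \<Omega> \<Longrightarrow> ((\<lambda>z. K (f z)) has_derivative (\<lambda>h. Re (q z * h))) (at z)"
    and K: "\<And>z. z \<in> \<Omega> \<Longrightarrow> (K has_real_derivative K1 (f z)) (at (f z))"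
    and K1: "(K1 has_real_derivative K2 (f z)) (at (f z))"
    and nz: "K1 (f z) \<noteq> 0"
  shows "(1 + (dy f z)\<^sup>2) * dx (dx f) z - 2 * dy (dx f) z * dx f z * dy f z
             + (1 + (dx f z)\<^sup>2) * dy (dy f) z = 0
     \<longleftrightarrow> K2 (f z) * (cmod (q z))\<^sup>2 = - Re ((q z)\<^sup>2 * cnj (deriv q z))"
    (is "?M = 0 \<longleftrightarrow> _")
proof -
  have first: "K1 (f w) * pd v f w = Re (q w * v)" if w: "w \<in> \<Omega>" for w v
  proof -
    have "f differentiable at w" by (rule smooth_plane_differentiable[OF smooth \<Omega>(1) w])
    then obtain D where D: "(f has_derivative D) (at w)" by (auto simp: differentiable_def)
    have "((\<lambda>z. K (f z)) has_derivative (\<lambda>h. K1 (f w) * D h)) (at w)"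
      by (rule has_derivative_compose[OF D K[OF w, unfolded has_field_derivative_def]])
    from has_derivative_unique[OF this Kf[OF w]] have "K1 (f w) * D v = Re (q w * v)"
      by (rule fun_cong)
    thus ?thesis by (simp add: pd_eqI[OF D])
  qed
  have q': "(q has_field_derivative deriv q z) (at z)"
    by (rule holomorphic_derivI[OF q \<Omega>])
  have second: "K2 (f z) * pd v f z * pd u f z + K1 (f z) * pd v (pd u f) z = Re (deriv q z * v * u)"
    if u: "u \<in> {1, \<i>}" for u v
  proof -
    have "f differentiable at z" "pd u f differentiable at z"
      using smooth_plane_differentiable[OF smooth \<Omega>] u by auto
    then obtain D E where D: "(f has_derivative D) (at z)" and E: "(pd u f has_derivative E) (at z)"
      by (auto simp: differentiable_def)
    have "((\<lambda>w. K1 (f w)) has_derivative (\<lambda>h. K2 (f z) * D h)) (at z)"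
      by (rule has_derivative_compose[OF D K1[unfolded has_field_derivative_def]])
    from has_derivative_mult[OF this E]
    have 1: "((\<lambda>w. K1 (f w) * pd u f w) has_derivative
            (\<lambda>h. K1 (f z) * E h + K2 (f z) * D h * pd u f z)) (at z)" .
    have "((\<lambda>w. Re (q w * u)) has_derivative (\<lambda>h. Re (deriv q z * u * h))) (at z)"
      by (rule has_derivative_Re_holomorphic[OF DERIV_cmult_right[OF q']])
    hence 2: "((\<lambda>w. K1 (f w) * pd u f w) has_derivative (\<lambda>h. Re (deriv q z * u * h))) (at z)"
      by (rule has_derivative_transform_within_open[OF _ \<Omega>]) (simp add: first)
    from has_derivative_unique[OF 1 2]
    have "K1 (f z) * E v + K2 (f z) * D v * pd u f z = Re (deriv q z * u * v)"
      by (rule fun_cong)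
    thus ?thesis by (simp add: pd_eqI[OF D] pd_eqI[OF E] mult_ac)
  qed
  \<comment> \<open>(a, b) is the gradient of the harmonic function \<open>K \<circ> f\<close>, and
    its Hessian has entries c, d, d, -c.\<close>
  define a b where "a = Re (q z)" and "b = - Im (q z)"
  define c d where "c = Re (deriv q z)" and "d = - Im (deriv q z)"
  define k1 k2 where "k1 = K1 (f z)" and "k2 = K2 (f z)"
  note defs = a_def[symmetric] b_def[symmetric] c_def[symmetric] d_def[symmetric]
    k1_def[symmetric] k2_def[symmetric]
  define p s where "p = dx f z" and "s = dy f z"
  have a: "a = k1 * p" and b: "b = k1 * s"
    using first[OF \<Omega>(2), of 1] first[OF \<Omega>(2), of \<i>]
    by (simp_all add: a_def b_def k1_def p_def s_def)
  have xx: "k1 * dx (dx f) z = c - k2 * p * p" and xy: "k1 * dy (dx f) z = d - k2 * p * s"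
    and yy: "k1 * dy (dy f) z = - c - k2 * s * s"
    using second[of 1 1] second[of 1 \<i>] second[of \<i> \<i>]
    by (simp_all add: c_def d_def k1_def k2_def p_def s_def mult_ac)
  \<comment> \<open>The third power clears all denominators. In the cubic part the \<open>k2\<close>
    terms cancel, because the second directional derivative along a level set does not see a
    reparametrisation of the values; \<open>k2\<close> survives only in the Laplacian.\<close>
  have "k1 ^ 3 * ?M = k1\<^sup>2 * ((1 + s\<^sup>2) * (k1 * dx (dx f) z) - 2 * (k1 * dy (dx f) z) * p * s
            + (1 + p\<^sup>2) * (k1 * dy (dy f) z))"
    unfolding p_def s_def by (simp add: algebra_simps power2_eq_square power3_eq_cube)
  also have "\<dots> = - (k2 * (a\<^sup>2 + b\<^sup>2)) - ((a\<^sup>2 - b\<^sup>2) * c + 2 * a * b * d)"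
    unfolding xx xy yy a b by (simp add: algebra_simps power2_eq_square)
  also have "a\<^sup>2 + b\<^sup>2 = (cmod (q z))\<^sup>2" by (simp add: cmod_power2 a_def b_def)
  also have "(a\<^sup>2 - b\<^sup>2) * c + 2 * a * b * d = Re ((q z)\<^sup>2 * cnj (deriv q z))"
    by (simp add: a_def b_def c_def d_def power2_eq_square)
  finally have "k1 ^ 3 * ?M = - (k2 * (cmod (q z))\<^sup>2) - Re ((q z)\<^sup>2 * cnj (deriv q z))" .
  moreover have "k1 ^ 3 \<noteq> 0" using nz by (simp add: k1_def)
  ultimately have "?M = 0 \<longleftrightarrow> - (k2 * (cmod (q z))\<^sup>2) - Re ((q z)\<^sup>2 * cnj (deriv q z)) = 0"
    by (metis mult_eq_0_iff)
  thus ?thesis unfolding k2_def by auto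
qed

section \<open>The harmonic function \<open>ln \<bar>tanh\<bar>\<close>\<close>

definition log_tanh :: "complex \<Rightarrow> complex \<Rightarrow> complex \<Rightarrow> real" where
  "log_tanh r c1 z = ln (cmod (tanh (r * (z + c1) / 2)))"

text \<open>The complex derivative of any local branch of log tanh (r (z + c1) / 2), of which
  \<open>log_tanh\<close> is the real part; thus the complex gradient x-derivative minus \<i> times
  y-derivative. It is also the function exp B of the overview.\<close>

definition log_tanh_grad :: "complex \<Rightarrow> complex \<Rightarrow> complex \<Rightarrow> complex" where
  "log_tanh_grad r c1 z = r / sinh (r * (z + c1))"

lemma sinh_half_nonzero:
  fixes \<zeta> :: complex
  assumes "sinh \<zeta> \<noteq> 0"
  shows "sinh (\<zeta> / 2) \<noteq> 0" "cosh (\<zeta> / 2) \<noteq> 0" "tanh (\<zeta> / 2) \<noteq> 0"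
  using assms sinh_double[of "\<zeta> / 2"] by (auto simp: tanh_def)

lemma has_field_derivative_tanh_half:
  assumes "sinh (r * (z + c1)) \<noteq> 0"
  shows "((\<lambda>z. tanh (r * (z + c1) / 2)) has_field_derivative
           log_tanh_grad r c1 z * tanh (r * (z + c1) / 2)) (at z)"
proof -
  define \<zeta> where "\<zeta> = r * (z + c1)"
  define T where "T = tanh (\<zeta> / 2)"
  note nz = sinh_half_nonzero[OF assms[folded \<zeta>_def]]
  have T': "((\<lambda>z. tanh (r * (z + c1) / 2)) has_field_derivative (1 - T\<^sup>2) * (r / 2)) (at z)"
    using nz unfolding T_def \<zeta>_def by (auto intro!: derivative_eq_intros)
  define C S where "C = cosh (\<zeta> / 2)" and "S = sinh (\<zeta> / 2)"
  have CS: "C \<noteq> 0" "S \<noteq> 0" "C\<^sup>2 = S\<^sup>2 + 1" "T = S / C" "sinh \<zeta> = 2 * S * C"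
    using nz sinh_double[of "\<zeta> / 2"] by (simp_all add: C_def S_def T_def cosh_square_eq tanh_def)
  have "1 - T\<^sup>2 = (C\<^sup>2 - S\<^sup>2) / C\<^sup>2" using CS(1,4) by (simp add: power_divide diff_divide_distrib)
  hence "1 - T\<^sup>2 = 1 / C\<^sup>2" using CS(3) by simp
  hence "(1 - T\<^sup>2) * (r / 2) = log_tanh_grad r c1 z * T"
    using CS(1,2) unfolding log_tanh_grad_def \<zeta>_def[symmetric] CS(4,5)
    by (simp add: power2_eq_square)
  with T' show ?thesis by (simp add: T_def \<zeta>_def)
qed

text \<open>Differentiating through the norm avoids a branch of the complex logarithm, so the result
  also holds where the tanh is a negative real number.\<close>

lemma has_derivative_log_tanh:
  assumes "sinh (r * (z + c1)) \<noteq> 0"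
  shows "(log_tanh r c1 has_derivative (\<lambda>h. Re (log_tanh_grad r c1 z * h))) (at z)"
proof -
  define T where "T = tanh (r * (z + c1) / 2)"
  define q where "q = log_tanh_grad r c1 z"
  have T0: "T \<noteq> 0" using sinh_half_nonzero[OF assms] by (simp add: T_def)
  have T': "((\<lambda>z. tanh (r * (z + c1) / 2)) has_derivative (\<lambda>h. q * T * h)) (at z)"
    using has_field_derivative_tanh_half[OF assms] unfolding q_def T_def
    by (simp only: has_field_derivative_def)
  have "((\<lambda>z. cmod (tanh (r * (z + c1) / 2))) has_derivative (\<lambda>h. (q * T * h) \<bullet> sgn T)) (at z)"
    using has_derivative_compose[OF T' has_derivative_norm[of T, unfolded T_def]] T0
    by (simp add: T_def)
  hence 1: "(log_tanh r c1 has_derivative (\<lambda>h. inverse (cmod T) * ((q * T * h) \<bullet> sgn T))) (at z)"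
    unfolding log_tanh_def
    using T0 has_derivative_compose[of "\<lambda>z. cmod (tanh (r * (z + c1) / 2))" _ z UNIV ln]
      DERIV_ln[of "cmod T", unfolded has_field_derivative_def]
    by (simp add: T_def)
  have 2: "q = q * T / T" using T0 by simp
  have "inverse (cmod T) * ((x * h) \<bullet> sgn T) = Re (x / T * h)" for x h
  proof -
    have "x / T * h = x * h * cnj T / (of_real ((cmod T)\<^sup>2))"
      unfolding complex_norm_square using T0 by simp
    hence "Re (x / T * h) = Re (x * h * cnj T) / (cmod T)\<^sup>2"
      by (simp only: Re_divide_of_real)
    also have "Re (x * h * cnj T) = (x * h) \<bullet> T"
      by (simp add: inner_complex_def)
    finally show ?thesis
      by (simp add: sgn_div_norm power2_eq_square inverse_eq_divide)
  qed
  with 1 show ?thesis unfolding q_def[symmetric] by (subst 2) (simp only:)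
qed

lemma has_field_derivative_log_tanh_grad:
  assumes "sinh (r * (z + c1)) \<noteq> 0"
  shows "(log_tanh_grad r c1 has_field_derivative
           - (r\<^sup>2 * cosh (r * (z + c1)) / (sinh (r * (z + c1)))\<^sup>2)) (at z)"
  unfolding log_tanh_grad_def using assms
  by (auto intro!: derivative_eq_intros simp: power2_eq_square)

text \<open>With \<zeta> = r (z + c1), the left side is |r|^4 Re (cosh \<zeta>) / |sinh \<zeta>|^4.
  Half-angle formulas express everything through x = |sinh (\<zeta> / 2)| and y = |cosh (\<zeta> /
  2)|, and v = ln (x / y). This is why a function of z reduces to a function of v.\<close>

lemma log_tanh_grad_curvature:
  assumes nz: "sinh (r * (z + c1)) \<noteq> 0" and "r \<noteq> 0"
  shows "- Re ((log_tanh_grad r c1 z)\<^sup>2 * cnj (deriv (log_tanh_grad r c1) z))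
    = - ((cmod r)\<^sup>2 * sinh (log_tanh r c1 z) * cosh (log_tanh r c1 z)) * (cmod (log_tanh_grad r c1 z))\<^sup>2"
proof -
  define \<zeta> where "\<zeta> = r * (z + c1)"
  define C S where "C = cosh (\<zeta> / 2)" and "S = sinh (\<zeta> / 2)"
  note nz' = nz[folded \<zeta>_def]
  have CS0: "C \<noteq> 0" "S \<noteq> 0" using sinh_half_nonzero[OF nz'] by (auto simp: C_def S_def)
  have cs: "C\<^sup>2 - S\<^sup>2 = 1" by (simp add: C_def S_def cosh_square_eq)
  have cosh: "cosh \<zeta> = C\<^sup>2 + S\<^sup>2" and sinh: "sinh \<zeta> = 2 * S * C"
    using cosh_double[of "\<zeta> / 2"] sinh_double[of "\<zeta> / 2"] by (simp_all add: C_def S_def)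
  define x y where "x = cmod S" and "y = cmod C"
  have xy: "x > 0" "y > 0" using CS0 by (auto simp: x_def y_def)
  have lt: "log_tanh r c1 z = ln (x / y)"
    by (simp add: log_tanh_def x_def y_def C_def S_def \<zeta>_def tanh_def norm_divide)
  have "sinh (log_tanh r c1 z) * cosh (log_tanh r c1 z) = ((x / y)\<^sup>2 - (y / x)\<^sup>2) / 4"
    using xy unfolding lt by (simp add: sinh_ln_real cosh_ln_real power2_eq_square field_simps)
  also have "\<dots> = (x ^ 4 - y ^ 4) / (4 * x\<^sup>2 * y\<^sup>2)"
    using xy by (simp add: field_simps power2_eq_square power4_eq_xxxx)
  finally have A: "sinh (log_tanh r c1 z) * cosh (log_tanh r c1 z) = (x ^ 4 - y ^ 4) / (4 * x\<^sup>2 * y\<^sup>2)" .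
  \<comment> \<open>Multiplying by the conjugate of \<open>C\<^sup>2 - S\<^sup>2\<close>, which
    equals 1, makes the real part a difference of squared moduli.\<close>
  have "Re (cosh \<zeta>) = Re ((C\<^sup>2 + S\<^sup>2) * cnj (C\<^sup>2 - S\<^sup>2))" by (simp add: cosh cs)
  also have "\<dots> = (cmod C) ^ 4 - (cmod S) ^ 4"
  proof -
    have "Re ((u + w) * cnj (u - w)) = (cmod u)\<^sup>2 - (cmod w)\<^sup>2" for u w
      unfolding cmod_power2 by (simp add: power2_eq_square algebra_simps)
    from this[of "C\<^sup>2" "S\<^sup>2"] show ?thesis by (simp only: norm_power) simp
  qed
  finally have B: "Re (cosh \<zeta>) = y ^ 4 - x ^ 4" by (simp add: x_def y_def)
  have "Re ((log_tanh_grad r c1 z)\<^sup>2 * cnj (deriv (log_tanh_grad r c1) z))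
      = - Re ((r * cnj r)\<^sup>2 / (sinh \<zeta> * cnj (sinh \<zeta>))\<^sup>2 * cnj (cosh \<zeta>))"
    unfolding DERIV_imp_deriv[OF has_field_derivative_log_tanh_grad[OF nz]] \<zeta>_def[symmetric]
    by (simp add: log_tanh_grad_def power_divide power_mult_distrib mult.assoc flip: \<zeta>_def)
  also have "(r * cnj r)\<^sup>2 / (sinh \<zeta> * cnj (sinh \<zeta>))\<^sup>2
      = of_real ((cmod r) ^ 4 / (cmod (sinh \<zeta>)) ^ 4)"
    by (simp add: complex_norm_square[symmetric])
  also have "Re (of_real ((cmod r) ^ 4 / (cmod (sinh \<zeta>)) ^ 4) * cnj (cosh \<zeta>))
      = (cmod r) ^ 4 / (cmod (sinh \<zeta>)) ^ 4 * Re (cosh \<zeta>)" by simp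
  also have "cmod (sinh \<zeta>) = 2 * x * y" by (simp add: sinh x_def y_def norm_mult)
  finally have "- Re ((log_tanh_grad r c1 z)\<^sup>2 * cnj (deriv (log_tanh_grad r c1) z))
      = (cmod r) ^ 4 / (2 * x * y) ^ 4 * (y ^ 4 - x ^ 4)" by (simp add: B)
  also have "\<dots> = - ((cmod r)\<^sup>2 * ((x ^ 4 - y ^ 4) / (4 * x\<^sup>2 * y\<^sup>2))) * ((cmod r)\<^sup>2 / (2 * x * y)\<^sup>2)"
  proof -
    have "a ^ 4 / (2 * x * y) ^ 4 * (y ^ 4 - x ^ 4)
        = - (a\<^sup>2 * ((x ^ 4 - y ^ 4) / (4 * x\<^sup>2 * y\<^sup>2))) * (a\<^sup>2 / (2 * x * y)\<^sup>2)" for a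
      using xy by (simp add: power_mult_distrib field_simps power2_eq_square power4_eq_xxxx)
    thus ?thesis .
  qed
  also have "(cmod r)\<^sup>2 / (2 * x * y)\<^sup>2 = (cmod (log_tanh_grad r c1 z))\<^sup>2"
    unfolding log_tanh_grad_def \<zeta>_def[symmetric] sinh
    by (simp add: norm_divide norm_mult power_divide x_def y_def)
  finally show ?thesis unfolding A[symmetric] by (simp add: mult.assoc)
qed

text \<open>Both sides of the general criterion now carry the nonvanishing factor |q|^2. Cancelling
  it leaves an equation in the value \<open>f z\<close> alone. The equivalence is used in both
  directions: to derive the profile equation from a surface, and to construct surfaces from
  profiles.\<close>

lemma minimal_surface_equation_log_tanh_iff:
  fixes K K1 K2 :: "real \<Rightarrow> real"
  assumes \<Omega>: "open \<Omega>" "z \<in> \<Omega>" and smooth: "smooth_plane \<Omega> f" and r: "r \<noteq> 0"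
    and sinh: "\<And>z. z \<in> \<Omega> \<Longrightarrow> sinh (r * (z + c1)) \<noteq> 0"
    and Kf: "\<And>z. z \<in> \<Omega> \<Longrightarrow> K (f z) = log_tanh r c1 z"
    and K: "\<And>z. z \<in> \<Omega> \<Longrightarrow> (K has_real_derivative K1 (f z)) (at (f z))"
    and K1: "(K1 has_real_derivative K2 (f z)) (at (f z))"
    and nz: "K1 (f z) \<noteq> 0"
  shows "(1 + (dy f z)\<^sup>2) * dx (dx f) z - 2 * dy (dx f) z * dx f z * dy f z
             + (1 + (dx f z)\<^sup>2) * dy (dy f) z = 0
     \<longleftrightarrow> K2 (f z) = - ((cmod r)\<^sup>2 * sinh (K (f z)) * cosh (K (f z)))"
proof -
  have hol: "log_tanh_grad r c1 holomorphic_on \<Omega>"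
    using has_field_derivative_log_tanh_grad[OF sinh] \<Omega>(1) by (auto simp: holomorphic_on_open)
  have der: "((\<lambda>z. K (f z)) has_derivative (\<lambda>h. Re (log_tanh_grad r c1 z * h))) (at z)" if "z \<in> \<Omega>" for z
    by (rule has_derivative_transform_within_open[OF has_derivative_log_tanh[OF sinh[OF that]] \<Omega>(1) that])
       (simp add: Kf)
  have "(cmod (log_tanh_grad r c1 z))\<^sup>2 \<noteq> 0"
    using sinh[OF \<Omega>(2)] r by (simp add: log_tanh_grad_def)
  hence "K2 (f z) * (cmod (log_tanh_grad r c1 z))\<^sup>2
        = - Re ((log_tanh_grad r c1 z)\<^sup>2 * cnj (deriv (log_tanh_grad r c1) z))
      \<longleftrightarrow> K2 (f z) = - ((cmod r)\<^sup>2 * sinh (K (f z)) * cosh (K (f z)))"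
    unfolding log_tanh_grad_curvature[OF sinh[OF \<Omega>(2)] r] Kf[OF \<Omega>(2)] by (rule mult_right_cancel)
  with minimal_surface_equation_iff[of \<Omega> z f "log_tanh_grad r c1" K K1 K2, OF \<Omega> smooth hol der K K1 nz]
  show ?thesis by (rule trans)
qed

section \<open>Every admissible pair is elliptic\<close>

lemma constant_of_zero_derivative:
  fixes F :: "'a::real_normed_vector \<Rightarrow> 'b::real_normed_vector"
  assumes "open \<Omega>" "connected \<Omega>" and "\<And>z. z \<in> \<Omega> \<Longrightarrow> (F has_derivative (\<lambda>h. 0)) (at z)"
  obtains c where "\<And>z. z \<in> \<Omega> \<Longrightarrow> F z = c"
proof (cases "\<Omega> = {}")
  case False
  then obtain w where "w \<in> \<Omega>" by blast
  hence "F z = F w" if "z \<in> \<Omega>" for z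
    using has_derivative_zero_unique_connected[OF assms] that by blast
  thus thesis by (rule that)
qed (use that in auto)

lemma constant_of_zero_field_derivative:
  fixes F :: "'a::real_normed_field \<Rightarrow> 'a"
  assumes "open \<Omega>" "connected \<Omega>" and "\<And>z. z \<in> \<Omega> \<Longrightarrow> (F has_field_derivative 0) (at z)"
  obtains c where "\<And>z. z \<in> \<Omega> \<Longrightarrow> F z = c"
proof -
  have "(*) 0 = (\<lambda>h :: 'a. 0)" by auto
  hence "(F has_derivative (\<lambda>h. 0)) (at z)" if "z \<in> \<Omega>" for z
    using assms(3)[OF that] by (simp only: has_field_derivative_def)
  thus thesis using constant_of_zero_derivative[OF assms(1,2)] that by metis
qed


section \<open>The complex differential equation for the derivative of \<open>A\<close>\<close>

lemma exp_solution_sinh: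
  assumes \<Omega>: "open \<Omega>" "connected \<Omega>" "\<Omega> \<noteq> {}" and r: "r \<noteq> 0"
    and B: "B holomorphic_on \<Omega>"
    and B1: "\<And>z. z \<in> \<Omega> \<Longrightarrow> (deriv B z)\<^sup>2 = exp (2 * B z) + r\<^sup>2"
    and B2: "\<And>z. z \<in> \<Omega> \<Longrightarrow> deriv (deriv B) z = exp (2 * B z)"
  obtains c1 where "\<And>z. z \<in> \<Omega> \<Longrightarrow> sinh (r * (z + c1)) \<noteq> 0"
    and "\<And>z. z \<in> \<Omega> \<Longrightarrow> exp (B z) = log_tanh_grad r c1 z"
proof -
  define w w1 where "w = (\<lambda>z. exp (- B z))" and "w1 = (\<lambda>z. - deriv B z * exp (- B z))"
  have dB: "(B has_field_derivative deriv B z) (at z)" if "z \<in> \<Omega>" for z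
    by (rule holomorphic_derivI[OF B \<Omega>(1) that])
  have ddB: "(deriv B has_field_derivative exp (2 * B z)) (at z)" if "z \<in> \<Omega>" for z
    using holomorphic_derivI[OF holomorphic_deriv[OF B \<Omega>(1)] \<Omega>(1) that] B2[OF that] by simp
  have dw: "(w has_field_derivative w1 z) (at z)" if "z \<in> \<Omega>" for z
    unfolding w_def w1_def by (rule derivative_eq_intros dB[OF that] refl | simp)+
  have dw1: "(w1 has_field_derivative r\<^sup>2 * w z) (at z)" if "z \<in> \<Omega>" for z
  proof -
    have "(w1 has_field_derivative - exp (2 * B z) * exp (- B z) + exp (- B z) * - deriv B z * - deriv B z) (at z)"
      unfolding w1_def by (rule derivative_eq_intros dB[OF that] ddB[OF that] refl)+
    also have "- exp (2 * B z) * exp (- B z) + exp (- B z) * - deriv B z * - deriv B z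
        = ((deriv B z)\<^sup>2 - exp (2 * B z)) * w z"
      by (simp add: w_def algebra_simps power2_eq_square)
    finally show ?thesis by (simp add: B1[OF that])
  qed
  have energy: "(w1 z)\<^sup>2 - r\<^sup>2 * (w z)\<^sup>2 = 1" if "z \<in> \<Omega>" for z
  proof -
    have "(w1 z)\<^sup>2 - r\<^sup>2 * (w z)\<^sup>2 = ((deriv B z)\<^sup>2 - r\<^sup>2) * (exp (- B z))\<^sup>2"
      by (simp add: w_def w1_def power_mult_distrib left_diff_distrib)
    also have "\<dots> = 1" by (simp add: B1[OF that] flip: exp_double exp_add)
    finally show ?thesis .
  qed
  \<comment> \<open>The operator w'' - r^2 w splits into two first-order factors, which makes these
    two combinations constant on the connected domain.\<close>
  define \<alpha> \<beta> where "\<alpha> = (\<lambda>z. (r * w z + w1 z) * exp (- r * z))" and "\<beta> = (\<lambda>z. (r * w z - w1 z) * exp (r * z))"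
  have "(\<alpha> has_field_derivative 0) (at z)" if "z \<in> \<Omega>" for z
    unfolding \<alpha>_def
    by (rule derivative_eq_intros dw[OF that] dw1[OF that] refl)+ (simp add: algebra_simps power2_eq_square)
  then obtain a where a: "\<And>z. z \<in> \<Omega> \<Longrightarrow> \<alpha> z = a"
    using constant_of_zero_field_derivative[OF \<Omega>(1,2)] by metis
  have "(\<beta> has_field_derivative 0) (at z)" if "z \<in> \<Omega>" for z
    unfolding \<beta>_def
    by (rule derivative_eq_intros dw[OF that] dw1[OF that] refl)+ (simp add: algebra_simps power2_eq_square)
  then obtain b where b: "\<And>z. z \<in> \<Omega> \<Longrightarrow> \<beta> z = b"
    using constant_of_zero_field_derivative[OF \<Omega>(1,2)] by metis
  obtain z0 where z0: "z0 \<in> \<Omega>" using \<Omega>(3) by blast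
  have "\<alpha> z0 * \<beta> z0 = (r * w z0 + w1 z0) * (r * w z0 - w1 z0) * (exp (- r * z0) * exp (r * z0))"
    by (simp add: \<alpha>_def \<beta>_def mult_ac)
  also have "\<dots> = - ((w1 z0)\<^sup>2 - r\<^sup>2 * (w z0)\<^sup>2)"
    by (simp add: algebra_simps power2_eq_square flip: exp_add)
  \<comment> \<open>The product of the two constants is minus the conserved quantity, so b = - 1 /
    a, and one shift \<open>c1\<close> accounts for both exponentials.\<close>
  finally have ab: "a * b = -1" using energy[OF z0] a[OF z0] b[OF z0] by simp
  hence "a \<noteq> 0" by auto
  define c1 where "c1 = Ln a / r"
  have c1: "exp (r * c1) = a" using r \<open>a \<noteq> 0\<close> by (simp add: c1_def)
  have c1': "exp (- (r * c1)) = - b"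
  proof -
    have "inverse a = - b" using ab by (intro inverse_unique) simp
    thus ?thesis by (simp only: exp_minus c1)
  qed
  have w: "sinh (r * (z + c1)) = r * w z" if z: "z \<in> \<Omega>" for z
  proof -
    have "exp (r * (z + c1)) = exp (r * z) * a" "exp (- (r * (z + c1))) = - (exp (- r * z) * b)"
      using c1 c1' by (simp_all add: distrib_left exp_add exp_diff exp_minus field_simps)
    moreover have "exp (r * z) * a = r * w z + w1 z"
      using a[OF z, symmetric] by (simp add: \<alpha>_def mult_ac flip: exp_add)
    moreover have "exp (- r * z) * b = r * w z - w1 z"
      using b[OF z, symmetric] by (simp add: \<beta>_def mult_ac flip: exp_add)
    ultimately show ?thesis by (simp add: sinh_field_def)
  qed
  show thesis
  proof (rule that)
    fix z assume z: "z \<in> \<Omega>"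
    show "sinh (r * (z + c1)) \<noteq> 0" using r by (simp add: w[OF z] w_def)
    show "exp (B z) = log_tanh_grad r c1 z"
      using r by (simp add: log_tanh_grad_def w[OF z] w_def exp_minus divide_inverse)
  qed
qed

text \<open>The logarithms \<open>L\<close> and \<open>B\<close> come from separate existentials.
  They are logarithms of functions that differ by the constant factor \<open>sqrt k\<close>, so
  their derivatives agree and the equations for \<open>k\<close> and \<open>c0\<close> can be
  combined.\<close>

lemma associated_derivative_sinh:
  assumes \<Omega>: "open \<Omega>" "connected \<Omega>" "\<Omega> \<noteq> {}" and r: "r \<noteq> 0" and k: "k > 0"
    and A: "A holomorphic_on \<Omega>" "associated_k \<Omega> A k" "associated_c0 \<Omega> A k (r\<^sup>2)"
  obtains c1 where "\<And>z. z \<in> \<Omega> \<Longrightarrow> sinh (r * (z + c1)) \<noteq> 0"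
    and "\<And>z. z \<in> \<Omega> \<Longrightarrow> of_real (sqrt k) * deriv A z = log_tanh_grad r c1 z"
proof -
  obtain L where L: "L holomorphic_on \<Omega>" "\<And>z. z \<in> \<Omega> \<Longrightarrow> exp (L z) = deriv A z"
    and L2: "\<And>z. z \<in> \<Omega> \<Longrightarrow> deriv (deriv L) z = of_real k * (deriv A z)\<^sup>2"
    using A(2) by (auto simp: associated_k_def holomorphic_log_on_def)
  obtain B where B: "B holomorphic_on \<Omega>" "\<And>z. z \<in> \<Omega> \<Longrightarrow> exp (B z) = of_real (sqrt k) * deriv A z"
    and B1: "\<And>z. z \<in> \<Omega> \<Longrightarrow> (deriv B z)\<^sup>2 = exp (2 * B z) + r\<^sup>2"
    using A(3) by (auto simp: associated_c0_def holomorphic_log_on_def)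
  have dL: "deriv B z = deriv L z" if z: "z \<in> \<Omega>" for z
  proof -
    have dB: "(B has_field_derivative deriv B z) (at z)" and dL: "(L has_field_derivative deriv L z) (at z)"
      using holomorphic_derivI[OF _ \<Omega>(1) z] B(1) L(1) by auto
    have 1: "((\<lambda>z. exp (B z)) has_field_derivative exp (B z) * deriv B z) (at z)"
      by (rule derivative_eq_intros dB refl)+
    have "((\<lambda>z. of_real (sqrt k) * exp (L z)) has_field_derivative of_real (sqrt k) * (exp (L z) * deriv L z)) (at z)"
      by (rule derivative_eq_intros dL refl)+ simp
    hence 2: "((\<lambda>z. exp (B z)) has_field_derivative of_real (sqrt k) * (exp (L z) * deriv L z)) (at z)"
      by (rule has_field_derivative_transform_within_open[OF _ \<Omega>(1) z]) (simp add: L(2) B(2))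
    have "exp (B z) * deriv B z = exp (B z) * deriv L z"
      using DERIV_unique[OF 1 2] by (simp add: L(2)[OF z] B(2)[OF z])
    thus ?thesis by simp
  qed
  \<comment> \<open>Taken from the equation for \<open>k\<close>: differentiating the first-order
    equation for \<open>B\<close> gives this only multiplied by B', and a constant \<open>B\<close>
    with exp (2 B) = - c0 solves that equation too.\<close>
  have B2: "deriv (deriv B) z = exp (2 * B z)" if z: "z \<in> \<Omega>" for z
  proof -
    have "eventually (\<lambda>z. z \<in> \<Omega>) (nhds z)" using \<Omega>(1) z by (rule eventually_nhds_in_open)
    hence "eventually (\<lambda>z. deriv B z = deriv L z) (nhds z)"
      by (rule eventually_mono) (rule dL)
    hence "deriv (deriv B) z = deriv (deriv L) z" by (rule deriv_cong_ev) simp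
    also have "\<dots> = (of_real (sqrt k) * deriv A z)\<^sup>2"
      using k by (simp add: L2[OF z] power_mult_distrib flip: of_real_power)
    also have "\<dots> = exp (2 * B z)" by (simp add: exp_double flip: B(2)[OF z])
    finally show ?thesis .
  qed
  obtain c1 where c1: "\<And>z. z \<in> \<Omega> \<Longrightarrow> sinh (r * (z + c1)) \<noteq> 0"
    "\<And>z. z \<in> \<Omega> \<Longrightarrow> exp (B z) = log_tanh_grad r c1 z"
    using exp_solution_sinh[OF \<Omega> r B(1) B1 B2] by metis
  show thesis by (rule that[OF c1(1)]) (simp_all add: c1(2) flip: B(2))
qed

text \<open>The map from \<kappa> to \<kappa>^2 / (1 - \<kappa>^2) takes (0, 1) onto the positive
  reals; \<kappa>^2 = E / (c + E) is the preimage of E / c.\<close>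

lemma modulus_of_ratio:
  fixes E c :: real
  assumes "E > 0" "c > 0"
  obtains \<kappa> where "0 < \<kappa>" "\<kappa> < 1" "E = c * (\<kappa>\<^sup>2 / (1 - \<kappa>\<^sup>2))"
proof
  let ?\<kappa> = "sqrt (E / (c + E))"
  show "0 < ?\<kappa>" "?\<kappa> < 1" using assms by auto
  have "?\<kappa>\<^sup>2 = E / (c + E)" using assms by simp
  moreover have "1 - E / (c + E) = c / (c + E)" using assms by (simp add: field_simps)
  ultimately show "E = c * (?\<kappa>\<^sup>2 / (1 - ?\<kappa>\<^sup>2))" using assms by simp
qed

text \<open>The function \<open>H\<close> of the hypothesis, rescaled and shifted to agree with v,
  serves as the profile \<open>K\<close>. The two first integrals \<open>E\<close> and
  \<open>E - F\<close> then yield the two moduli.\<close>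

lemma admissible_pair_elliptic:
  assumes adm: "admissible_pair \<Omega> f U g" and ne: "\<Omega> \<noteq> {}" and r: "r \<noteq> 0" and k: "k > 0"
    and A: "associated_function \<Omega> f g A" "associated_k \<Omega> A k" "associated_c0 \<Omega> A k (r\<^sup>2)"
  obtains \<gamma> \<Lambda> where "\<gamma> \<in> {0<..<1}" "\<Lambda> \<in> {0<..<1}" "elliptic_representation \<Omega> f g (r\<^sup>2) r \<gamma> \<Lambda>"
proof -
  define I where "I = f ` \<Omega>"
  define h where "h = first_characteristic g"
  have \<Omega>: "open \<Omega>" "connected \<Omega>" and f: "smooth_plane \<Omega> f"
    and eq: "\<And>z. z \<in> \<Omega> \<Longrightarrow> (1 + (dy f z)\<^sup>2) * dx (dx f) z - 2 * dy (dx f) z * dx f z * dy f z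
             + (1 + (dx f z)\<^sup>2) * dy (dy f) z = 0"
    and U: "open U" "smooth_line U g" "I \<subseteq> U" and gf: "minimal_graph_surface \<Omega> (g \<circ> f)"
    and g_nz: "\<And>s. s \<in> U \<Longrightarrow> (deriv g s) ^ 3 - deriv g s \<noteq> 0" and h_nz: "\<And>s. s \<in> I \<Longrightarrow> h s \<noteq> 0"
    using adm by (auto simp: admissible_pair_def minimal_graph_surface_def minimal_graph_transformation_def I_def h_def)
  have contf: "continuous_on \<Omega> f"
    using smooth_plane_differentiable(1)[OF f \<Omega>(1)]
    by (meson continuous_at_imp_continuous_on differentiable_imp_continuous_within)
  have I: "connected I" unfolding I_def using \<Omega>(2) contf by (simp add: connected_continuous_image)
  have holA: "A holomorphic_on \<Omega>" using A(1) by (simp add: associated_function_def)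
  obtain H1 H where ball: "\<forall>s\<in>I. (H1 has_real_derivative h s) (at s)"
      "\<forall>s\<in>I. (H has_real_derivative exp (- H1 s)) (at s)"
      "\<forall>z\<in>\<Omega>. complex_of_real (H (f z)) = A z + cnj (A z)"
    using A(1)[unfolded associated_function_def, folded I_def h_def] by (elim conjE exE) (rule that; assumption)
  note H1 = bspec[OF ball(1)] and H = bspec[OF ball(2)] and HA = bspec[OF ball(3)]
  obtain c1 where sinh: "\<And>z. z \<in> \<Omega> \<Longrightarrow> sinh (r * (z + c1)) \<noteq> 0"
    and A': "\<And>z. z \<in> \<Omega> \<Longrightarrow> of_real (sqrt k) * deriv A z = log_tanh_grad r c1 z"
    using associated_derivative_sinh[OF \<Omega> ne r k holA A(2,3)] by metis
  \<comment> \<open>Since H(f) = 2 Re A, and sqrt k times A' is the complex gradient of v, the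
    function b H(f) differs from v by a constant.\<close>
  define b where "b = sqrt k / 2"
  have b: "b > 0" using k by (simp add: b_def)
  have HRe: "H (f z) = 2 * Re (A z)" if "z \<in> \<Omega>" for z
    using HA[OF that] by (simp add: complex_eq_iff)
  have "((\<lambda>z. sqrt k * Re (A z) - log_tanh r c1 z) has_derivative (\<lambda>h. 0)) (at z)" if z: "z \<in> \<Omega>" for z
  proof -
    have "((\<lambda>z. sqrt k * Re (A z)) has_derivative (\<lambda>h. sqrt k * Re (deriv A z * h))) (at z)"
      by (intro has_derivative_mult_right has_derivative_Re_holomorphic holomorphic_derivI[OF holA \<Omega>(1) z])
    moreover have "sqrt k * Re (deriv A z * h) = Re (log_tanh_grad r c1 z * h)" for h
      by (simp flip: A'[OF z]) (simp add: algebra_simps)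
    ultimately have "((\<lambda>z. sqrt k * Re (A z)) has_derivative (\<lambda>h. Re (log_tanh_grad r c1 z * h))) (at z)"
      by (simp only:)
    from has_derivative_diff[OF this has_derivative_log_tanh[OF sinh[OF z]]]
    show ?thesis by (simp only: diff_self)
  qed
  from constant_of_zero_derivative[OF \<Omega> this]
  obtain C where C: "\<And>z. z \<in> \<Omega> \<Longrightarrow> sqrt k * Re (A z) - log_tanh r c1 z = C" by metis

  define K K1 K2 where "K = (\<lambda>s. b * H s - C)" and "K1 = (\<lambda>s. b * exp (- H1 s))"
    and "K2 = (\<lambda>s. - h s * (b * exp (- H1 s)))"
  have Kf: "K (f z) = log_tanh r c1 z" if "z \<in> \<Omega>" for z
    using C[OF that] by (simp add: K_def HRe[OF that] b_def)
  have K: "(K has_real_derivative K1 s) (at s)" if "s \<in> I" for s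
    unfolding K_def K1_def by (rule derivative_eq_intros H[OF that] refl)+ simp
  have K1: "(K1 has_real_derivative K2 s) (at s)" if "s \<in> I" for s
    unfolding K1_def K2_def by (rule derivative_eq_intros H1[OF that] refl)+ simp
  have K1_pos: "K1 s > 0" for s using b by (simp add: K1_def)
  have K2: "K2 s = - ((cmod r)\<^sup>2 * sinh (K s) * cosh (K s))" if "s \<in> I" for s
  proof -
    \<comment> \<open>Every s in \<open>I\<close> is a value of \<open>f\<close>, so the pointwise
      criterion becomes a differential equation on the whole interval.\<close>
    obtain z where z: "z \<in> \<Omega>" "s = f z" using \<open>s \<in> I\<close> by (auto simp: I_def)
    show ?thesis unfolding z(2)
      using minimal_surface_equation_log_tanh_iff[OF \<Omega>(1) z(1) f r sinh Kf, of K1 K2] eq[OF z(1)] K K1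
        K1_pos z by (auto simp: I_def less_imp_neq[symmetric])
  qed
  \<comment> \<open>A zero of \<open>K\<close> would be a zero of K'' and hence of h = - K'' / K'.
    Thus nonvanishing of the first characteristic keeps v away from 0.\<close>
  have K_nz: "K s \<noteq> 0" if "s \<in> I" for s
  proof
    assume "K s = 0"
    hence "K2 s = 0" using K2[OF that] by simp
    thus False using h_nz[OF that] b by (simp add: K2_def)
  qed

  define g1 where "g1 = deriv g"
  have diff: "(deriv ^^ n) g differentiable at s" if "s \<in> U" for n s
    using U that by (force simp: smooth_line_def differentiable_on_def dest: at_within_open)
  have g: "(g has_real_derivative g1 s) (at s)" if "s \<in> U" for s
    using diff[OF that, of 0] by (simp add: g1_def DERIV_deriv_iff_real_differentiable)
  have g1: "(g1 has_real_derivative deriv g1 s) (at s)" if "s \<in> U" for s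
    using diff[OF that, of 1] by (simp add: g1_def DERIV_deriv_iff_real_differentiable)
  have g1_nz: "g1 s \<noteq> 0" "(g1 s)\<^sup>2 \<noteq> 1" if "s \<in> U" for s
    using g_nz[OF that] by (auto simp: g1_def power3_eq_cube power2_eq_square)
  have g2: "deriv g1 s = h s * ((g1 s) ^ 3 - g1 s)" if "s \<in> U" for s
    using g_nz[OF that] by (simp add: h_def first_characteristic_def g1_def)

  have "((\<lambda>s. (K1 s)\<^sup>2 + (cmod r)\<^sup>2 * (sinh (K s))\<^sup>2) has_real_derivative 0) (at s)" if s: "s \<in> I" for s
    by (rule derivative_eq_intros K[OF s] K1[OF s] refl)+ (simp add: K2[OF s])
  from has_real_derivative_zero_constant_on_connected[OF I this]
  obtain E where E: "\<And>s. s \<in> I \<Longrightarrow> (K1 s)\<^sup>2 + (cmod r)\<^sup>2 * (sinh (K s))\<^sup>2 = E"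
    by metis
  \<comment> \<open>The cubic equation for g' is linear in 1 / g'^2: the factor 1 - 1 / g'^2 has
    logarithmic derivative 2 h wherever it is nonzero, and K'^2 has - 2 h.\<close>
  have "((\<lambda>s. (K1 s)\<^sup>2 * (1 - 1 / (g1 s)\<^sup>2)) has_real_derivative 0) (at s)" if s: "s \<in> I" for s
  proof -
    have sU: "s \<in> U" using s U by auto
    have K2h: "K2 s = - h s * K1 s" by (simp add: K2_def K1_def)
    have nz: "g1 s \<noteq> 0" by (rule g1_nz[OF sU])
    have "((\<lambda>s. 1 / (g1 s)\<^sup>2) has_real_derivative
        - (2 * g1 s * deriv g1 s) / ((g1 s)\<^sup>2 * (g1 s)\<^sup>2)) (at s)"
      using DERIV_divide[OF DERIV_const DERIV_power[OF g1[OF sU], of 2], of 1] nz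
      by (simp add: mult_ac)
    also have "- (2 * g1 s * deriv g1 s) / ((g1 s)\<^sup>2 * (g1 s)\<^sup>2) = - 2 * h s * (1 - 1 / (g1 s)\<^sup>2)"
    proof -
      have "- (2 * y * (h s * (y ^ 3 - y))) / (y\<^sup>2 * y\<^sup>2) = - 2 * h s * (1 - 1 / y\<^sup>2)"
        if "y \<noteq> 0" for y
        using that by (simp add: divide_simps) (simp add: algebra_simps power2_eq_square power3_eq_cube power4_eq_xxxx)
      from this[OF nz] show ?thesis unfolding g2[OF sU] .
    qed
    finally have "((\<lambda>s. 1 / (g1 s)\<^sup>2) has_real_derivative - 2 * h s * (1 - 1 / (g1 s)\<^sup>2)) (at s)" .
    from DERIV_mult[OF DERIV_power[OF K1[OF s], of 2] DERIV_diff[OF DERIV_const this]]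
    show ?thesis by (rule DERIV_cong) (simp add: K2h power2_eq_square algebra_simps)
  qed
  from has_real_derivative_zero_constant_on_connected[OF I this]
  obtain F where F: "\<And>s. s \<in> I \<Longrightarrow> (K1 s)\<^sup>2 * (1 - 1 / (g1 s)\<^sup>2) = F"
    by metis
  have E': "(K1 s)\<^sup>2 = (g1 s)\<^sup>2 * (E - F - (cmod r)\<^sup>2 * (sinh (K s))\<^sup>2)" if s: "s \<in> I" for s
  proof -
    have nz: "g1 s \<noteq> 0" using g1_nz s U by auto
    have "E - F - (cmod r)\<^sup>2 * (sinh (K s))\<^sup>2 = (K1 s)\<^sup>2 * (1 / (g1 s)\<^sup>2)"
      using E[OF s] F[OF s] by (simp add: algebra_simps)
    thus ?thesis using nz by simp
  qed
  obtain s0 where s0: "s0 \<in> I" using ne by (auto simp: I_def)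
  have r2: "(cmod r)\<^sup>2 > 0" using r by simp
  have "E > 0" using E[OF s0] K1_pos[of s0] r by (smt (verit) zero_less_power mult_nonneg_nonneg zero_le_power2)
  \<comment> \<open>One point of \<open>I\<close> suffices: there K'^2 is positive, and dropping the
    nonnegative sinh term leaves a positive constant. Both constants thus lie in the range of
    \<open>modulus_of_ratio\<close>.\<close>
  moreover have "E - F > 0"
  proof -
    have "0 < (g1 s0)\<^sup>2 * (E - F - (cmod r)\<^sup>2 * (sinh (K s0))\<^sup>2)"
      using E'[OF s0] K1_pos[of s0] by (metis zero_less_power)
    hence "0 < E - F - (cmod r)\<^sup>2 * (sinh (K s0))\<^sup>2"
      by (simp add: zero_less_mult_iff)
    thus ?thesis by (smt (verit) mult_nonneg_nonneg zero_le_power2)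
  qed
  ultimately obtain \<gamma> \<Lambda> where \<gamma>: "0 < \<gamma>" "\<gamma> < 1" "E = (cmod r)\<^sup>2 * (\<gamma>\<^sup>2 / (1 - \<gamma>\<^sup>2))"
    and \<Lambda>: "0 < \<Lambda>" "\<Lambda> < 1" "E - F = (cmod r)\<^sup>2 * (\<Lambda>\<^sup>2 / (1 - \<Lambda>\<^sup>2))"
    using modulus_of_ratio r2 by metis
  have "elliptic_representation \<Omega> f g (r\<^sup>2) r \<gamma> \<Lambda>"
  proof (rule elliptic_representation_of_profile[OF \<Omega>(2) contf gf \<gamma>(1,2) \<Lambda>(1,2),
        where K = K and ?K1.0 = K1 and ?g1.0 = g1 and ?c1.0 = c1, folded I_def])
    show "r\<^sup>2 \<noteq> 0" using r by simp
    show "tanh (r * (z + c1) / 2) \<noteq> 0" if "z \<in> \<Omega>" for z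
      using sinh_half_nonzero(3)[OF sinh[OF that]] by simp
    show "K (f z) = ln (cmod (tanh (r * (z + c1) / 2)))" if "z \<in> \<Omega>" for z
      using Kf[OF that] by (simp add: log_tanh_def)
    show "(g has_real_derivative g1 s) (at s)" "g1 s \<noteq> 0" if "s \<in> I" for s
      using g g1_nz that U by auto
    show "continuous_on I K1" "continuous_on I g1"
      using K1 g1 U by (meson DERIV_isCont continuous_at_imp_continuous_on subsetD)+
    show "K1 s \<noteq> 0" for s using K1_pos[of s] by simp
    show "(K1 s)\<^sup>2 = cmod (r\<^sup>2) * (\<gamma>\<^sup>2 / (1 - \<gamma>\<^sup>2) - (sinh (K s))\<^sup>2)" if "s \<in> I" for s
      using E[OF that] unfolding \<gamma>(3) by (simp add: norm_power right_diff_distrib)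
    show "(K1 s)\<^sup>2 = (g1 s)\<^sup>2 * (cmod (r\<^sup>2) * (\<Lambda>\<^sup>2 / (1 - \<Lambda>\<^sup>2) - (sinh (K s))\<^sup>2))" if "s \<in> I" for s
      using E'[OF that] unfolding \<Lambda>(3) by (simp add: norm_power right_diff_distrib)
  qed (use K K_nz in auto)
  with \<gamma> \<Lambda> show thesis using that[of \<gamma> \<Lambda>] by auto
qed

section \<open>Smoothness of function algebras closed under differentiation\<close>

text \<open>A device for smoothness of all orders: once the first derivative of every generator lies
  in the algebra, every iterated derivative does, and no formula for it is required.\<close>

inductive_set function_algebra :: "('a \<Rightarrow> real) set \<Rightarrow> ('a \<Rightarrow> real) set"
  for G :: "('a \<Rightarrow> real) set" where
  gen: "f \<in> G \<Longrightarrow> f \<in> function_algebra G"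
| const: "(\<lambda>_. c) \<in> function_algebra G"
| add: "f \<in> function_algebra G \<Longrightarrow> g \<in> function_algebra G \<Longrightarrow> (\<lambda>x. f x + g x) \<in> function_algebra G"
| mult: "f \<in> function_algebra G \<Longrightarrow> g \<in> function_algebra G \<Longrightarrow> (\<lambda>x. f x * g x) \<in> function_algebra G"

lemma function_algebra_power:
  assumes "f \<in> function_algebra G"
  shows "(\<lambda>x. f x ^ n) \<in> function_algebra G"
  by (induction n) (auto intro: function_algebra.intros assms)

lemma smooth_line_function_algebra:
  assumes U: "open U" and f: "f \<in> function_algebra G"
    and G: "\<And>f. f \<in> G \<Longrightarrow> \<exists>p\<in>function_algebra G. \<forall>s\<in>U. (f has_real_derivative p s) (at s)"
  shows "smooth_line U f"
proof -
  have closed: "\<exists>p\<in>function_algebra G. \<forall>s\<in>U. (f has_real_derivative p s) (at s)"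
    if "f \<in> function_algebra G" for f
    using that
  proof induction
    case (gen f)
    thus ?case by (rule G)
  next
    case (const c)
    show ?case by (rule bexI[OF _ function_algebra.const[of 0]]) simp
  next
    case (add f g)
    then obtain p q where "p \<in> function_algebra G" "q \<in> function_algebra G"
      "\<forall>s\<in>U. (f has_real_derivative p s) (at s)" "\<forall>s\<in>U. (g has_real_derivative q s) (at s)" by blast
    thus ?case by (intro bexI[of _ "\<lambda>s. p s + q s"]) (auto intro: function_algebra.add DERIV_add)
  next
    case (mult f g)
    then obtain p q where "p \<in> function_algebra G" "q \<in> function_algebra G"
      "\<forall>s\<in>U. (f has_real_derivative p s) (at s)" "\<forall>s\<in>U. (g has_real_derivative q s) (at s)" by blast
    with mult show ?case
      by (intro bexI[of _ "\<lambda>s. p s * g s + q s * f s"])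
         (auto intro: function_algebra.add function_algebra.mult DERIV_mult)
  qed
  \<comment> \<open>The iterates of \<open>deriv\<close> are controlled only on \<open>U\<close>, so
    the induction carries agreement on \<open>U\<close> with a member of the algebra; openness of
    \<open>U\<close> lets derivatives be transferred.\<close>
  have iterate: "\<exists>p\<in>function_algebra G. \<forall>s\<in>U. (deriv ^^ n) f s = p s" for n
  proof (induction n)
    case 0
    show ?case using f by auto
  next
    case (Suc n)
    then obtain p where p: "p \<in> function_algebra G" "\<And>s. s \<in> U \<Longrightarrow> (deriv ^^ n) f s = p s" by blast
    obtain q where q: "q \<in> function_algebra G" "\<And>s. s \<in> U \<Longrightarrow> (p has_real_derivative q s) (at s)"
      using closed[OF p(1)] by blast
    have "((deriv ^^ n) f has_real_derivative q s) (at s)" if "s \<in> U" for s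
      by (rule has_field_derivative_transform_within_open[OF q(2)[OF that] U that]) (simp add: p(2))
    hence "(deriv ^^ Suc n) f s = q s" if "s \<in> U" for s
      using that by (simp add: DERIV_imp_deriv)
    with q(1) show ?case by blast
  qed
  have "(deriv ^^ n) f differentiable_on U" for n
  proof -
    obtain p where p: "p \<in> function_algebra G" "\<And>s. s \<in> U \<Longrightarrow> (deriv ^^ n) f s = p s"
      using iterate by blast
    obtain q where q: "\<And>s. s \<in> U \<Longrightarrow> (p has_real_derivative q s) (at s)"
      using closed[OF p(1)] by blast
    have "((deriv ^^ n) f has_real_derivative q s) (at s)" if "s \<in> U" for s
      by (rule has_field_derivative_transform_within_open[OF q[OF that] U that]) (simp add: p(2))
    thus ?thesis
      by (meson differentiable_at_imp_differentiable_on real_differentiable_def)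
  qed
  thus ?thesis by (simp add: smooth_line_def)
qed

lemma bex2_ballI: "p \<in> A \<Longrightarrow> q \<in> A \<Longrightarrow> (\<And>z. z \<in> \<Omega> \<Longrightarrow> P p q z) \<Longrightarrow> \<exists>p\<in>A. \<exists>q\<in>A. \<forall>z\<in>\<Omega>. P p q z"
  by blast

text \<open>The planar analogue. The pair \<open>p\<close>, \<open>q\<close> is the gradient: the
  stated derivative takes the value \<open>p\<close> in direction 1 and \<open>q\<close> in
  direction \<i>.\<close>

lemma smooth_plane_function_algebra:
  assumes \<Omega>: "open \<Omega>" and f: "f \<in> function_algebra G"
    and G: "\<And>f. f \<in> G \<Longrightarrow> \<exists>p\<in>function_algebra G. \<exists>q\<in>function_algebra G.
              \<forall>z\<in>\<Omega>. (f has_derivative (\<lambda>h. Re h * p z + Im h * q z)) (at z)"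
  shows "smooth_plane \<Omega> f"
proof -
  have closed: "\<exists>p\<in>function_algebra G. \<exists>q\<in>function_algebra G.
              \<forall>z\<in>\<Omega>. (f has_derivative (\<lambda>h. Re h * p z + Im h * q z)) (at z)"
    if "f \<in> function_algebra G" for f
    using that
  proof induction
    case (gen f)
    thus ?case by (rule G)
  next
    case (const c)
    show ?case
      by (rule bexI[OF _ function_algebra.const[of 0]], rule bexI[OF _ function_algebra.const[of 0]]) simp
  next
    case (add f1 f2)
    then obtain p1 q1 p2 q2 where *:
        "p1 \<in> function_algebra G" "q1 \<in> function_algebra G" "p2 \<in> function_algebra G" "q2 \<in> function_algebra G"
      and d: "\<And>z. z \<in> \<Omega> \<Longrightarrow> (f1 has_derivative (\<lambda>h. Re h * p1 z + Im h * q1 z)) (at z)"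
         "\<And>z. z \<in> \<Omega> \<Longrightarrow> (f2 has_derivative (\<lambda>h. Re h * p2 z + Im h * q2 z)) (at z)" by blast
    have "((\<lambda>z. f1 z + f2 z) has_derivative (\<lambda>h. Re h * (p1 z + p2 z) + Im h * (q1 z + q2 z))) (at z)"
      if "z \<in> \<Omega>" for z
      using has_derivative_add[OF d(1)[OF that] d(2)[OF that]] by (simp add: algebra_simps)
    moreover have "(\<lambda>z. p1 z + p2 z) \<in> function_algebra G" "(\<lambda>z. q1 z + q2 z) \<in> function_algebra G"
      using * by (auto intro: function_algebra.add)
    ultimately show ?case
      by (intro bex2_ballI[of "\<lambda>z. p1 z + p2 z" _ "\<lambda>z. q1 z + q2 z"])
  next
    case (mult f1 f2)
    then obtain p1 q1 p2 q2 where *: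
        "p1 \<in> function_algebra G" "q1 \<in> function_algebra G" "p2 \<in> function_algebra G" "q2 \<in> function_algebra G"
      and d: "\<And>z. z \<in> \<Omega> \<Longrightarrow> (f1 has_derivative (\<lambda>h. Re h * p1 z + Im h * q1 z)) (at z)"
         "\<And>z. z \<in> \<Omega> \<Longrightarrow> (f2 has_derivative (\<lambda>h. Re h * p2 z + Im h * q2 z)) (at z)" by blast
    have "((\<lambda>z. f1 z * f2 z) has_derivative
        (\<lambda>h. Re h * (p1 z * f2 z + f1 z * p2 z) + Im h * (q1 z * f2 z + f1 z * q2 z))) (at z)"
      if "z \<in> \<Omega>" for z
      using has_derivative_mult[OF d(1)[OF that] d(2)[OF that]] by (simp add: algebra_simps)
    moreover have "(\<lambda>z. p1 z * f2 z + f1 z * p2 z) \<in> function_algebra G"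
      "(\<lambda>z. q1 z * f2 z + f1 z * q2 z) \<in> function_algebra G"
      using * mult.hyps by (auto intro: function_algebra.intros)
    ultimately show ?case
      by (intro bex2_ballI[of "\<lambda>z. p1 z * f2 z + f1 z * p2 z" _ "\<lambda>z. q1 z * f2 z + f1 z * q2 z"])
  qed
  have pd_closed: "\<exists>p\<in>function_algebra G. \<forall>z\<in>\<Omega>. foldr pd vs f z = p z" if "set vs \<subseteq> {1, \<i>}" for vs
    using that
  proof (induction vs)
    case Nil
    show ?case using f by auto
  next
    case (Cons v vs)
    then obtain g where g: "g \<in> function_algebra G" "\<And>z. z \<in> \<Omega> \<Longrightarrow> foldr pd vs f z = g z" by auto
    obtain p q where pq: "p \<in> function_algebra G" "q \<in> function_algebra G"
      "\<And>z. z \<in> \<Omega> \<Longrightarrow> (g has_derivative (\<lambda>h. Re h * p z + Im h * q z)) (at z)"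
      using closed[OF g(1)] by blast
    have d: "(foldr pd vs f has_derivative (\<lambda>h. Re h * p z + Im h * q z)) (at z)" if "z \<in> \<Omega>" for z
      by (rule has_derivative_transform_within_open[OF pq(3)[OF that] \<Omega> that]) (simp add: g(2))
    have "foldr pd (v # vs) f z = Re v * p z + Im v * q z" if "z \<in> \<Omega>" for z
      using pd_eqI[OF d[OF that], of v] by simp
    moreover have "v = 1 \<or> v = \<i>" using Cons.prems by auto
    ultimately show ?case using pq(1,2) by auto
  qed
  have "foldr pd vs f differentiable_on \<Omega>" if vs: "set vs \<subseteq> {1, \<i>}" for vs
  proof -
    obtain g where g: "g \<in> function_algebra G" "\<And>z. z \<in> \<Omega> \<Longrightarrow> foldr pd vs f z = g z"
      using pd_closed[OF vs] by blast
    obtain p q where d: "\<And>z. z \<in> \<Omega> \<Longrightarrow> (g has_derivative (\<lambda>h. Re h * p z + Im h * q z)) (at z)"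
      using closed[OF g(1)] by blast
    have "(foldr pd vs f has_derivative (\<lambda>h. Re h * p z + Im h * q z)) (at z)" if "z \<in> \<Omega>" for z
      by (rule has_derivative_transform_within_open[OF d[OF that] \<Omega> that]) (simp add: g(2))
    thus ?thesis by (meson differentiable_at_imp_differentiable_on differentiable_def)
  qed
  thus ?thesis by (simp add: smooth_plane_def)
qed

section \<open>Profiles with prescribed modulus\<close>

text \<open>K' as a function of the value t of K: the positive root of the first integral with
  modulus \<kappa>, where \<open>c\<close> stands for |c0|.\<close>

definition profile_speed :: "real \<Rightarrow> real \<Rightarrow> real \<Rightarrow> real" where
  "profile_speed c \<kappa> t = sqrt (c * (\<kappa>\<^sup>2 / (1 - \<kappa>\<^sup>2) - (sinh t)\<^sup>2))"

text \<open>If K' is itself the speed, the quotient cancels and the second-order profile equation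
  K'' = - c sinh K cosh K appears.\<close>

lemma has_real_derivative_profile_speed:
  assumes "profile_speed c \<kappa> t > 0" and K: "(K has_real_derivative K') (at s)" and "K s = t"
  shows "((\<lambda>s. profile_speed c \<kappa> (K s)) has_real_derivative
           - (c * sinh t * cosh t) / profile_speed c \<kappa> t * K') (at s)"
proof -
  have pos: "0 < c * (\<kappa>\<^sup>2 / (1 - \<kappa>\<^sup>2) - (sinh t)\<^sup>2)" using assms(1) by (simp add: profile_speed_def)
  have sq: "((\<lambda>t. c * (\<kappa>\<^sup>2 / (1 - \<kappa>\<^sup>2) - (sinh t)\<^sup>2)) has_real_derivative - (2 * c * sinh t * cosh t)) (at t)"
    using DERIV_cmult[OF DERIV_diff[OF DERIV_const
            DERIV_power[OF has_field_derivative_sinh[OF DERIV_ident], of 2]], of c "\<kappa>\<^sup>2 / (1 - \<kappa>\<^sup>2)" t]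
    by (simp add: mult_ac)
  have eq: "inverse S / 2 * - (2 * c * x * y) = - (c * x * y) / S" for S x y :: real
    by (simp add: inverse_eq_divide)
  from DERIV_chain2[OF DERIV_real_sqrt[OF pos] sq]
  have "(profile_speed c \<kappa> has_real_derivative - (c * sinh t * cosh t) / profile_speed c \<kappa> t) (at t)"
    unfolding profile_speed_def[abs_def] by (simp only: eq)
  from DERIV_chain2[OF this[folded \<open>K s = t\<close>] K] show ?thesis unfolding \<open>K s = t\<close> .
qed

text \<open>The autonomous equation K' = P(K) is solved by quadrature: an antiderivative of 1 / P is
  strictly increasing, and its inverse is K.\<close>

lemma profile_inverse:
  fixes V :: "real set"
  assumes V: "open V" "connected V"
    and \<Phi>: "\<And>t. t \<in> V \<Longrightarrow> (\<Phi> has_real_derivative 1 / P t) (at t)" and P: "\<And>t. t \<in> V \<Longrightarrow> P t > 0"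
  obtains K where "open (\<Phi> ` V)" and "\<And>t. t \<in> V \<Longrightarrow> K (\<Phi> t) = t"
    and "\<And>t. t \<in> V \<Longrightarrow> (K has_real_derivative P t) (at (\<Phi> t))"
proof -
  have less: "\<Phi> x < \<Phi> y" if "x \<in> V" "y \<in> V" "x < y" for x y
  proof (rule DERIV_pos_imp_increasing[OF that(3)])
    fix t assume "x \<le> t" "t \<le> y"
    hence t: "t \<in> V" using V(2) that(1,2) by (meson connected_iff_interval)
    have "0 < 1 / P t" using P[OF t] by simp
    with \<Phi>[OF t] show "\<exists>d. (\<Phi> has_real_derivative d) (at t) \<and> 0 < d" by blast
  qed
  have inj: "inj_on \<Phi> V" by (rule inj_onI) (metis less less_irrefl linorder_neqE_linordered_idom)
  have cont: "continuous_on V \<Phi>"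
    using \<Phi> by (meson DERIV_isCont continuous_at_imp_continuous_on)
  have inv: "the_inv_into V \<Phi> (\<Phi> t) = t" if "t \<in> V" for t by (rule the_inv_into_f_f[OF inj that])
  show thesis
  proof (rule that)
    show "open (\<Phi> ` V)" by (rule invariance_of_domain[OF cont V(1) inj])
    show "the_inv_into V \<Phi> (\<Phi> t) = t" if "t \<in> V" for t by (rule inv[OF that])
    show "(the_inv_into V \<Phi> has_real_derivative P t) (at (\<Phi> t))" if t: "t \<in> V" for t
    proof -
      have "(*) (1 / P t) \<circ> (*) (P t) = id" using P[OF t] by (auto simp: fun_eq_iff)
      from has_derivative_inverse_strong[OF V(1) t cont inv \<Phi>[OF t, unfolded has_field_derivative_def] this]
      show ?thesis by (simp add: has_field_derivative_def)
    qed
  qed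
qed

lemma profile_exists:
  assumes c: "c > 0" and P: "\<And>t. t \<in> {a..b} \<Longrightarrow> profile_speed c \<kappa> t > 0"
  obtains \<Phi> K where "open (\<Phi> ` {a<..<b})" and "\<And>t. t \<in> {a<..<b} \<Longrightarrow> K (\<Phi> t) = t"
    and "\<And>t. t \<in> {a<..<b} \<Longrightarrow> (\<Phi> has_real_derivative 1 / profile_speed c \<kappa> t) (at t)"
    and "\<And>t. t \<in> {a<..<b} \<Longrightarrow> (K has_real_derivative profile_speed c \<kappa> t) (at (\<Phi> t))"
proof -
  have nz: "profile_speed c \<kappa> t \<noteq> 0" if "t \<in> {a..b}" for t using P[OF that] by simp
  have "continuous_on {a..b} (\<lambda>t. 1 / profile_speed c \<kappa> t)"
    by (intro continuous_intros ballI nz) (auto simp: profile_speed_def intro!: continuous_intros)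
  then obtain \<Phi> where \<Phi>: "\<And>t. t \<in> {a..b} \<Longrightarrow>
      (\<Phi> has_vector_derivative 1 / profile_speed c \<kappa> t) (at t within {a..b})"
    using antiderivative_continuous by metis
  have d\<Phi>: "(\<Phi> has_real_derivative 1 / profile_speed c \<kappa> t) (at t)" if t: "t \<in> {a<..<b}" for t
  proof -
    have "at t within {a..b} = at t" by (rule at_within_interior) (use t in auto)
    moreover have "t \<in> {a..b}" using t by auto
    ultimately show ?thesis
      using \<Phi>[of t] by (simp add: has_real_derivative_iff_has_vector_derivative)
  qed
  obtain K where "open (\<Phi> ` {a<..<b})" "\<And>t. t \<in> {a<..<b} \<Longrightarrow> K (\<Phi> t) = t"
      "\<And>t. t \<in> {a<..<b} \<Longrightarrow> (K has_real_derivative profile_speed c \<kappa> t) (at (\<Phi> t))"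
    using profile_inverse[of "{a<..<b}" \<Phi> "profile_speed c \<kappa>", OF _ _ d\<Phi>] P by auto
  with d\<Phi> show thesis using that by blast
qed

text \<open>Composing v with the inverse of a profile gives a minimal graph. It is applied to
  \<gamma> for \<open>f\<close> and to \<Lambda> for \<open>g \<circ> f\<close>.\<close>

lemma profile_minimal_graph:
  assumes \<Omega>: "open \<Omega>" "connected \<Omega>" and r: "r \<noteq> 0" and V: "\<And>z. z \<in> \<Omega> \<Longrightarrow> log_tanh r c1 z \<in> V"
    and sinh: "\<And>z. z \<in> \<Omega> \<Longrightarrow> sinh (r * (z + c1)) \<noteq> 0"
    and c: "c = (cmod r)\<^sup>2" and P: "\<And>t. t \<in> V \<Longrightarrow> profile_speed c \<kappa> t > 0"
    and inv: "\<And>t. t \<in> V \<Longrightarrow> K (\<Phi> t) = t"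
    and \<Phi>: "\<And>t. t \<in> V \<Longrightarrow> (\<Phi> has_real_derivative 1 / profile_speed c \<kappa> t) (at t)"
    and K: "\<And>t. t \<in> V \<Longrightarrow> (K has_real_derivative profile_speed c \<kappa> t) (at (\<Phi> t))"
    and F: "\<And>z. z \<in> \<Omega> \<Longrightarrow> F z = \<Phi> (log_tanh r c1 z)"
  shows "minimal_graph_surface \<Omega> F" and "\<And>z. z \<in> \<Omega> \<Longrightarrow> (dx F z)\<^sup>2 + (dy F z)\<^sup>2 \<noteq> 0"
proof -
  define v q where "v = log_tanh r c1" and "q = log_tanh_grad r c1"
  define P1 where "P1 = profile_speed c \<kappa>"
  have vV: "v z \<in> V" if "z \<in> \<Omega>" for z using V[OF that] by (simp add: v_def)
  have dv: "(v has_derivative (\<lambda>h. Re (q z * h))) (at z)" if "z \<in> \<Omega>" for z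
    unfolding v_def q_def by (rule has_derivative_log_tanh[OF sinh[OF that]])
  have comp: "((\<lambda>z. \<phi> (v z)) has_derivative (\<lambda>h. Re h * (d * Re (q z)) + Im h * (d * Re (\<i> * q z)))) (at z)"
    if "z \<in> \<Omega>" "(\<phi> has_real_derivative d) (at (v z))" for \<phi> d z
    using has_derivative_compose[OF dv[OF that(1)] that(2)[unfolded has_field_derivative_def]]
    by (simp add: algebra_simps)
  have dF: "(F has_derivative (\<lambda>h. Re h * (1 / P1 (v z) * Re (q z)) + Im h * (1 / P1 (v z) * Re (\<i> * q z)))) (at z)"
    if z: "z \<in> \<Omega>" for z
    by (rule has_derivative_transform_within_open[OF comp[OF z \<Phi>[OF vV[OF z]], folded P1_def] \<Omega>(1) z])
       (simp add: F v_def)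
  \<comment> \<open>The generators close up: the gradient of \<open>F\<close> is 1 / P1 times that
    of v, sinh and cosh of v reproduce each other, and real parts of holomorphic functions have
    partial derivatives of the same kind. Using 1 / P1 instead of P1 keeps its own derivative
    polynomial in the generators.\<close>
  define G where "G = {F, \<lambda>z. sinh (v z), \<lambda>z. cosh (v z), \<lambda>z. 1 / P1 (v z)}
    \<union> {\<lambda>z. Re (Q z) |Q. Q holomorphic_on \<Omega>}"
  have hol: "q holomorphic_on \<Omega>"
    unfolding q_def using has_field_derivative_log_tanh_grad[OF sinh] \<Omega>(1) by (auto simp: holomorphic_on_open)
  have alg: "(\<lambda>z. sinh (v z)) \<in> function_algebra G" "(\<lambda>z. cosh (v z)) \<in> function_algebra G"
      "(\<lambda>z. 1 / P1 (v z)) \<in> function_algebra G"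
    by (auto intro!: function_algebra.gen simp: G_def)
  have algRe: "(\<lambda>z. Re (Q z)) \<in> function_algebra G" if "Q holomorphic_on \<Omega>" for Q
    using that by (auto intro!: function_algebra.gen simp: G_def)
  have algq: "(\<lambda>z. Re (q z)) \<in> function_algebra G" "(\<lambda>z. Re (\<i> * q z)) \<in> function_algebra G"
    by (intro algRe holomorphic_intros hol)+
  have compG: "\<exists>p\<in>function_algebra G. \<exists>p'\<in>function_algebra G.
      \<forall>z\<in>\<Omega>. ((\<lambda>z. \<phi> (v z)) has_derivative (\<lambda>h. Re h * p z + Im h * p' z)) (at z)"
    if "d \<in> function_algebra G" "\<And>z. z \<in> \<Omega> \<Longrightarrow> (\<phi> has_real_derivative d z) (at (v z))" for \<phi> d
    using comp[OF _ that(2)] function_algebra.mult[OF that(1) algq(1)] function_algebra.mult[OF that(1) algq(2)]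
    by (intro bex2_ballI[of "\<lambda>z. d z * Re (q z)" _ "\<lambda>z. d z * Re (\<i> * q z)"])
  have smooth: "smooth_plane \<Omega> F"
  proof (rule smooth_plane_function_algebra[OF \<Omega>(1)])
    show "F \<in> function_algebra G" by (rule function_algebra.gen) (simp add: G_def)
  next
    fix f assume "f \<in> G"
    then consider "f = F" | "f = (\<lambda>z. sinh (v z))" | "f = (\<lambda>z. cosh (v z))" | "f = (\<lambda>z. 1 / P1 (v z))"
      | Q where "f = (\<lambda>z. Re (Q z))" "Q holomorphic_on \<Omega>"
      by (auto simp: G_def)
    thus "\<exists>p\<in>function_algebra G. \<exists>q\<in>function_algebra G.
              \<forall>z\<in>\<Omega>. (f has_derivative (\<lambda>h. Re h * p z + Im h * q z)) (at z)"
    proof cases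
      case 1
      show ?thesis unfolding 1
        by (intro bex2_ballI[of "\<lambda>z. 1 / P1 (v z) * Re (q z)" _ "\<lambda>z. 1 / P1 (v z) * Re (\<i> * q z)"]
              function_algebra.mult alg algq dF)
    next
      case 2
      show ?thesis unfolding 2 by (rule compG[OF alg(2)]) (rule derivative_eq_intros refl | simp)+
    next
      case 3
      show ?thesis unfolding 3 by (rule compG[OF alg(1)]) (rule derivative_eq_intros refl | simp)+
    next
      case 4
      have "(\<lambda>z. c * sinh (v z) * cosh (v z) * (1 / P1 (v z)) ^ 3) \<in> function_algebra G"
        by (intro function_algebra.mult function_algebra.const function_algebra_power alg)
      thus ?thesis unfolding 4
      proof (rule compG)
        fix z assume z: "z \<in> \<Omega>"
        have pos: "P1 (v z) > 0" unfolding P1_def by (rule P[OF vV[OF z]])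
        have "(P1 has_real_derivative - (c * sinh (v z) * cosh (v z)) / P1 (v z)) (at (v z))"
          using has_real_derivative_profile_speed[OF P[OF vV[OF z]] DERIV_ident refl] by (simp add: P1_def)
        from DERIV_inverse_fun[OF this] pos
        show "((\<lambda>t. 1 / P1 t) has_real_derivative c * sinh (v z) * cosh (v z) * (1 / P1 (v z)) ^ 3) (at (v z))"
          by (simp add: inverse_eq_divide power3_eq_cube power2_eq_square mult.assoc)
      qed
    next
      case 5
      have hol': "deriv Q holomorphic_on \<Omega>" by (rule holomorphic_deriv[OF 5(2) \<Omega>(1)])
      have "((\<lambda>z. Re (Q z)) has_derivative (\<lambda>h. Re h * Re (deriv Q z) + Im h * Re (\<i> * deriv Q z))) (at z)"
        if "z \<in> \<Omega>" for z
        using has_derivative_Re_holomorphic[OF holomorphic_derivI[OF 5(2) \<Omega>(1) that]]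
        by (simp add: algebra_simps)
      moreover have "(\<lambda>z. Re (deriv Q z)) \<in> function_algebra G" "(\<lambda>z. Re (\<i> * deriv Q z)) \<in> function_algebra G"
        by (intro algRe holomorphic_intros hol')+
      ultimately show ?thesis
        unfolding 5(1) by (intro bex2_ballI[of "\<lambda>z. Re (deriv Q z)" _ "\<lambda>z. Re (\<i> * deriv Q z)"])
    qed
  qed
  have KF: "K (F z) = v z" if "z \<in> \<Omega>" for z using inv[OF vV[OF that]] F[OF that] by (simp add: v_def)
  show "minimal_graph_surface \<Omega> F"
    unfolding minimal_graph_surface_def
  proof (intro conjI ballI)
    show "open \<Omega>" "connected \<Omega>" "smooth_plane \<Omega> F" by (fact \<Omega> smooth)+
    fix z assume z: "z \<in> \<Omega>"
    have pos: "P1 (v z) > 0" unfolding P1_def by (rule P[OF vV[OF z]])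
    have K': "(K has_real_derivative P1 (K (F w))) (at (F w))" if w: "w \<in> \<Omega>" for w
      unfolding KF[OF w] using K[OF vV[OF w]] F[OF w] by (simp add: P1_def v_def)
    have K1: "((\<lambda>s. P1 (K s)) has_real_derivative - (c * sinh (K (F z)) * cosh (K (F z)))) (at (F z))"
      using has_real_derivative_profile_speed[OF P[OF vV[OF z]] K'[OF z] KF[OF z]] pos
      by (simp add: P1_def KF[OF z] mult.assoc)
    show "(1 + (dy F z)\<^sup>2) * dx (dx F) z - 2 * dy (dx F) z * dx F z * dy F z
             + (1 + (dx F z)\<^sup>2) * dy (dy F) z = 0"
      using minimal_surface_equation_log_tanh_iff[of \<Omega> z F r c1 K "\<lambda>s. P1 (K s)"
          "\<lambda>s. - (c * sinh (K s) * cosh (K s))", OF \<Omega>(1) z smooth r sinh KF[unfolded v_def] K' K1]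
        pos by (simp add: KF[OF z] c)
  qed
  fix z assume z: "z \<in> \<Omega>"
  have pos: "P1 (v z) > 0" unfolding P1_def by (rule P[OF vV[OF z]])
  have "q z \<noteq> 0" using sinh[OF z] r by (simp add: q_def log_tanh_grad_def)
  hence "Re (q z) / P1 (v z) \<noteq> 0 \<or> Im (q z) / P1 (v z) \<noteq> 0" using pos by (auto simp: complex_eq_iff)
  moreover have "dx F z = Re (q z) / P1 (v z)" "dy F z = - (Im (q z) / P1 (v z))"
    using pd_eqI[OF dF[OF z]] by simp_all
  ultimately show "(dx F z)\<^sup>2 + (dy F z)\<^sup>2 \<noteq> 0" by (simp add: sum_power2_eq_zero_iff)
qed

section \<open>Every pair of distinct moduli occurs\<close>

lemma sinh_complex_of_real: "sinh (complex_of_real t) = complex_of_real (sinh t)"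
  by (simp add: sinh_field_def exp_of_real flip: of_real_minus)

lemma tanh_complex_of_real: "tanh (complex_of_real t) = complex_of_real (tanh t)"
  by (simp add: tanh_altdef exp_of_real flip: of_real_minus)

text \<open>Where r z is a large positive real number, tanh is just below 1, so v is negative and
  close to 0. By continuity this persists on a ball. Avoiding the slit of nonpositive reals makes
  the principal logarithms of sinh and tanh holomorphic there.\<close>

lemma log_tanh_domain_exists:
  assumes r: "r \<noteq> 0" and m: "(m::real) > 0"
  obtains \<Omega> where "\<Omega> \<noteq> {}" "open \<Omega>" "convex \<Omega>"
    and "\<And>z. z \<in> \<Omega> \<Longrightarrow> sinh (r * z) \<notin> \<real>\<^sub>\<le>\<^sub>0" and "\<And>z. z \<in> \<Omega> \<Longrightarrow> tanh (r * z / 2) \<notin> \<real>\<^sub>\<le>\<^sub>0"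
    and "\<And>z. z \<in> \<Omega> \<Longrightarrow> log_tanh r 0 z \<in> {-m<..<0}"
proof -
  have "((\<lambda>x::real. ln (tanh x)) \<longlongrightarrow> ln 1) at_top"
    by (intro tendsto_intros tanh_real_at_top) auto
  hence "eventually (\<lambda>x::real. ln (tanh x) > - m) at_top"
    using m by (intro order_tendstoD(1)) auto
  moreover have "eventually (\<lambda>x::real. x > 0) at_top" by (rule eventually_gt_at_top)
  ultimately have "eventually (\<lambda>x::real. ln (tanh x) > - m \<and> x > 0) at_top" by (rule eventually_conj)
  then obtain x :: real where x: "ln (tanh x) > - m" "x > 0"
    using eventually_happens'[OF trivial_limit_at_top_linorder] by blast
  have tx: "0 < tanh x" "tanh x < 1" using x(2) tanh_real_lt_1 by auto
  define z0 where "z0 = complex_of_real (2 * x) / r"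
  have rz0: "r * z0 = complex_of_real (2 * x)" using r by (simp add: z0_def)
  have rz0': "r * z0 / 2 = complex_of_real x" using rz0 by simp
  have s0: "sinh (r * z0) \<notin> \<real>\<^sub>\<le>\<^sub>0" unfolding rz0 sinh_complex_of_real using x by simp
  hence s0': "sinh (r * (z0 + 0)) \<noteq> 0" by auto
  have t0: "tanh (r * z0 / 2) \<notin> \<real>\<^sub>\<le>\<^sub>0" unfolding rz0' tanh_complex_of_real using tx by simp
  have l0: "log_tanh r 0 z0 \<in> {-m<..<0}"
    unfolding log_tanh_def add_0_right rz0' tanh_complex_of_real using x tx by simp
  have ev: "eventually (\<lambda>z. F z \<in> S) (nhds z0)"
    if "isCont F z0" "open S" "F z0 \<in> S" for F :: "complex \<Rightarrow> 'b::topological_space" and S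
    using that by (simp add: isCont_def tendsto_at_iff_tendsto_nhds topological_tendstoD)
  have op: "open (- \<real>\<^sub>\<le>\<^sub>0 :: complex set)" by (simp add: open_Compl)
  have "isCont (\<lambda>z. sinh (r * z)) z0" by (intro continuous_intros)
  from ev[OF this op] s0 have 1: "eventually (\<lambda>z. sinh (r * z) \<in> - \<real>\<^sub>\<le>\<^sub>0) (nhds z0)" by simp
  have "isCont (\<lambda>z. tanh (r * z / 2)) z0"
    using DERIV_isCont[OF has_field_derivative_tanh_half[OF s0']] by simp
  from ev[OF this op] t0 have 2: "eventually (\<lambda>z. tanh (r * z / 2) \<in> - \<real>\<^sub>\<le>\<^sub>0) (nhds z0)" by simp
  have "isCont (log_tanh r 0) z0" by (rule has_derivative_continuous[OF has_derivative_log_tanh[OF s0']])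
  from ev[OF this open_greaterThanLessThan l0]
  have 3: "eventually (\<lambda>z. log_tanh r 0 z \<in> {-m<..<0}) (nhds z0)" .
  from eventually_conj[OF 1 eventually_conj[OF 2 3]]
  obtain d where d: "d > 0" "\<And>z. dist z z0 < d \<Longrightarrow> sinh (r * z) \<in> - \<real>\<^sub>\<le>\<^sub>0 \<and>
      tanh (r * z / 2) \<in> - \<real>\<^sub>\<le>\<^sub>0 \<and> log_tanh r 0 z \<in> {-m<..<0}"
    unfolding eventually_nhds_metric by blast
  show thesis
    by (rule that[of "ball z0 d"]) (use d in \<open>auto simp: dist_commute\<close>)
qed

lemma common_speed_interval:
  assumes c: "c > 0" and "0 < \<gamma>" "\<gamma> < 1" "0 < \<Lambda>" "\<Lambda> < (1::real)"
  obtains m where "m > 0"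
    and "\<And>t. t \<in> {-m..0} \<Longrightarrow> profile_speed c \<gamma> t > 0" and "\<And>t. t \<in> {-m..0} \<Longrightarrow> profile_speed c \<Lambda> t > 0"
proof -
  \<comment> \<open>On the resulting interval sinh^2 is at most \<kappa>^2 for either modulus, and
    \<kappa>^2 is below \<kappa>^2 / (1 - \<kappa>^2). The closed interval includes 0 so that 1 /
    speed is continuous up to both ends.\<close>
  define m where "m = arsinh (min \<gamma> \<Lambda>)"
  have m: "m > 0" using assms by (simp add: m_def)
  have pos: "profile_speed c \<kappa> t > 0" if t: "t \<in> {-m..0}" and \<kappa>: "0 < \<kappa>" "\<kappa> < 1" "min \<gamma> \<Lambda> \<le> \<kappa>" for \<kappa> t
  proof -
    have "sinh (- t) \<le> sinh m" using t by (simp only: sinh_real_le_iff) simp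
    hence "- sinh t \<le> min \<gamma> \<Lambda>" by (simp add: m_def)
    hence "- sinh t \<le> \<kappa>" by (rule order_trans[OF _ \<kappa>(3)])
    moreover have "0 \<le> - sinh t" using t by simp
    ultimately have "(- sinh t)\<^sup>2 \<le> \<kappa>\<^sup>2" by (intro power_mono)
    moreover have "\<kappa>\<^sup>2 < \<kappa>\<^sup>2 / (1 - \<kappa>\<^sup>2)"
    proof -
      have "0 < \<kappa>\<^sup>2" "0 < 1 - \<kappa>\<^sup>2" using \<kappa> by (auto simp: abs_square_less_1)
      thus ?thesis by (simp add: less_divide_eq)
    qed
    ultimately show ?thesis using c by (simp add: profile_speed_def)
  qed
  show thesis by (rule that[OF m]) (use pos assms in auto)
qed

text \<open>The map from the \<gamma>-profile to the \<Lambda>-profile has derivative P / Q, the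
  ratio of the two speeds. The third claim exhibits c sinh K cosh K / P as the factor relating g''
  to g'^3 - g', that is, the first characteristic function.\<close>

lemma smooth_line_profile_transition:
  fixes c \<gamma> \<Lambda> :: real and K g :: "real \<Rightarrow> real"
  defines "P \<equiv> \<lambda>s. profile_speed c \<gamma> (K s)" and "Q \<equiv> \<lambda>s. profile_speed c \<Lambda> (K s)"
  assumes U: "open U" and PQ: "\<And>s. s \<in> U \<Longrightarrow> P s > 0" "\<And>s. s \<in> U \<Longrightarrow> Q s > 0"
    and K: "\<And>s. s \<in> U \<Longrightarrow> (K has_real_derivative P s) (at s)"
    and g: "\<And>s. s \<in> U \<Longrightarrow> (g has_real_derivative P s * (1 / Q s)) (at s)"
  shows "smooth_line U g"
    and "\<And>s. s \<in> U \<Longrightarrow> (P has_real_derivative - (c * sinh (K s) * cosh (K s))) (at s)"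
    and "\<And>s. s \<in> U \<Longrightarrow> ((\<lambda>s. P s * (1 / Q s)) has_real_derivative
            c * sinh (K s) * cosh (K s) / P s * ((P s / Q s) ^ 3 - P s / Q s)) (at s)"
proof -
  show P': "(P has_real_derivative - (c * sinh (K s) * cosh (K s))) (at s)" if s: "s \<in> U" for s
    using has_real_derivative_profile_speed[OF _ K[OF s] refl, of c \<gamma>] PQ(1)[OF s] unfolding P_def by simp
  have Q': "((\<lambda>s. 1 / Q s) has_real_derivative c * sinh (K s) * cosh (K s) * P s * (1 / Q s) ^ 3) (at s)"
    if s: "s \<in> U" for s
  proof -
    have pos: "Q s > 0" by (rule PQ(2)[OF s])
    have "(Q has_real_derivative - (c * sinh (K s) * cosh (K s)) / Q s * P s) (at s)"
      using has_real_derivative_profile_speed[OF _ K[OF s] refl, of c \<Lambda>] pos unfolding Q_def by simp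
    from DERIV_inverse_fun[OF this] pos show ?thesis
      by (simp add: inverse_eq_divide power3_eq_cube power2_eq_square mult_ac)
  qed
  show "((\<lambda>s. P s * (1 / Q s)) has_real_derivative
            c * sinh (K s) * cosh (K s) / P s * ((P s / Q s) ^ 3 - P s / Q s)) (at s)" if s: "s \<in> U" for s
  proof (rule DERIV_cong[OF DERIV_mult[OF P'[OF s] Q'[OF s]]])
    have "- a * (1 / y) + a * x * (1 / y) ^ 3 * x = a / x * ((x / y) ^ 3 - x / y)"
      if "x \<noteq> 0" "y \<noteq> 0" for a x y :: real
      using that by (simp add: power3_eq_cube right_diff_distrib)
    from this[of "P s" "Q s" "c * sinh (K s) * cosh (K s)"] PQ[OF s]
    show "- (c * sinh (K s) * cosh (K s)) * (1 / Q s) + c * sinh (K s) * cosh (K s) * P s * (1 / Q s) ^ 3 * P s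
        = c * sinh (K s) * cosh (K s) / P s * ((P s / Q s) ^ 3 - P s / Q s)"
      by simp
  qed
  define G where "G = {g, P, \<lambda>s. 1 / Q s, \<lambda>s. sinh (K s), \<lambda>s. cosh (K s)}"
  have alg: "P \<in> function_algebra G" "(\<lambda>s. 1 / Q s) \<in> function_algebra G"
      "(\<lambda>s. sinh (K s)) \<in> function_algebra G" "(\<lambda>s. cosh (K s)) \<in> function_algebra G"
    by (auto intro!: function_algebra.gen simp: G_def)
  show "smooth_line U g"
  proof (rule smooth_line_function_algebra[OF U])
    show "g \<in> function_algebra G" by (rule function_algebra.gen) (simp add: G_def)
  next
    fix f assume "f \<in> G"
    then consider "f = g" | "f = P" | "f = (\<lambda>s. 1 / Q s)" | "f = (\<lambda>s. sinh (K s))" | "f = (\<lambda>s. cosh (K s))"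
      by (auto simp: G_def)
    thus "\<exists>p\<in>function_algebra G. \<forall>s\<in>U. (f has_real_derivative p s) (at s)"
    proof cases
      case 1
      show ?thesis unfolding 1
        by (intro bexI[of _ "\<lambda>s. P s * (1 / Q s)"] ballI g function_algebra.mult alg)
    next
      case 2
      have "(P has_real_derivative (- c) * sinh (K s) * cosh (K s)) (at s)" if "s \<in> U" for s
        using P'[OF that] by simp
      thus ?thesis unfolding 2
        by (intro bexI[of _ "\<lambda>s. (- c) * sinh (K s) * cosh (K s)"] ballI
              function_algebra.mult function_algebra.const alg)
    next
      case 3
      show ?thesis unfolding 3
        by (intro bexI[of _ "\<lambda>s. c * sinh (K s) * cosh (K s) * P s * (1 / Q s) ^ 3"] ballI Q'
              function_algebra.mult function_algebra.const function_algebra_power alg)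
    next
      case 4
      show ?thesis unfolding 4
        by (intro bexI[of _ "\<lambda>s. cosh (K s) * P s"] ballI function_algebra.mult alg
              has_field_derivative_sinh K)
    next
      case 5
      show ?thesis unfolding 5
        by (intro bexI[of _ "\<lambda>s. sinh (K s) * P s"] ballI function_algebra.mult alg
              has_field_derivative_cosh K)
    qed
  qed
qed

text \<open>Here sqrt k A' = r / sinh (r z) has the logarithm B = Ln r - Ln (sinh (r z)), with B' =
  - r coth (r z) and B'' = r^2 / sinh^2 (r z). Both defining equations then reduce to cosh^2 -
  sinh^2 = 1; the logarithm for \<open>k\<close> differs from \<open>B\<close> by the constant ln
  (sqrt k).\<close>

lemma associated_constants_Ln_tanh:
  assumes \<Omega>: "open \<Omega>" and r: "r \<noteq> 0" and k: "k > 0"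
    and sinh: "\<And>z. z \<in> \<Omega> \<Longrightarrow> sinh (r * z) \<notin> \<real>\<^sub>\<le>\<^sub>0"
    and tanh: "\<And>z. z \<in> \<Omega> \<Longrightarrow> tanh (r * z / 2) \<notin> \<real>\<^sub>\<le>\<^sub>0"
  defines "A \<equiv> \<lambda>z. Ln (tanh (r * z / 2)) / of_real (sqrt k)"
  shows "A holomorphic_on \<Omega>" "associated_k \<Omega> A k" "associated_c0 \<Omega> A k (r\<^sup>2)"
proof -
  define q where "q = log_tanh_grad r 0"
  define B where "B = (\<lambda>z. Ln r - Ln (sinh (r * z)))"
  have sk: "complex_of_real (sqrt k) \<noteq> 0" using k by simp
  have sinh0: "sinh (r * (z + 0)) \<noteq> 0" if "z \<in> \<Omega>" for z using sinh[OF that] by auto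
  have dA: "(A has_field_derivative q z / of_real (sqrt k)) (at z)" if z: "z \<in> \<Omega>" for z
  proof -
    define T where "T = (\<lambda>z. tanh (r * z / 2))"
    have T: "(T has_field_derivative q z * T z) (at z)"
      using has_field_derivative_tanh_half[OF sinh0[OF z]] by (simp add: T_def q_def)
    have T0: "T z \<notin> \<real>\<^sub>\<le>\<^sub>0" using tanh[OF z] by (simp add: T_def)
    hence "T z \<noteq> 0" by auto
    have "((\<lambda>z. Ln (T z)) has_field_derivative inverse (T z) * (q z * T z)) (at z)"
      by (rule DERIV_chain2[OF has_field_derivative_Ln[OF T0] T])
    also have "inverse (T z) * (q z * T z) = q z" using \<open>T z \<noteq> 0\<close> by simp
    finally show ?thesis unfolding A_def T_def by (rule DERIV_cdivide)
  qed
  show "A holomorphic_on \<Omega>" using dA \<Omega> by (auto simp: holomorphic_on_open)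
  have A': "of_real (sqrt k) * deriv A z = q z" if "z \<in> \<Omega>" for z
    using DERIV_imp_deriv[OF dA[OF that]] sk by simp
  have dB: "(B has_field_derivative - (r * cosh (r * z) / sinh (r * z))) (at z)" if z: "z \<in> \<Omega>" for z
  proof -
    have "((\<lambda>z. sinh (r * z)) has_field_derivative cosh (r * z) * r) (at z)"
      by (auto intro!: derivative_eq_intros)
    from DERIV_diff[OF DERIV_const[of "Ln r"] DERIV_chain2[OF has_field_derivative_Ln[OF sinh[OF z]] this]]
    show ?thesis by (simp add: B_def divide_inverse mult_ac)
  qed
  have holB: "B holomorphic_on \<Omega>" using dB \<Omega> by (auto simp: holomorphic_on_open)
  have expB: "exp (B z) = q z" if z: "z \<in> \<Omega>" for z
    using r sinh0[OF z] by (simp add: B_def exp_diff q_def log_tanh_grad_def)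
  have B1: "deriv B z = - (r * cosh (r * z) / sinh (r * z))" if "z \<in> \<Omega>" for z
    by (rule DERIV_imp_deriv[OF dB[OF that]])
  have B2: "deriv (deriv B) z = (q z)\<^sup>2" if z: "z \<in> \<Omega>" for z
  proof -
    have nz: "sinh (r * z) \<noteq> 0" using sinh0[OF z] by simp
    have "((\<lambda>z. - (r * cosh (r * z) / sinh (r * z))) has_field_derivative
        - ((r * (sinh (r * z) * r) * sinh (r * z) - r * cosh (r * z) * (cosh (r * z) * r)) / (sinh (r * z) * sinh (r * z)))) (at z)"
      using nz by (auto intro!: derivative_eq_intros)
    also have "- ((r * (sinh (r * z) * r) * sinh (r * z) - r * cosh (r * z) * (cosh (r * z) * r)) / (sinh (r * z) * sinh (r * z)))
        = r\<^sup>2 * ((cosh (r * z))\<^sup>2 - (sinh (r * z))\<^sup>2) / (sinh (r * z))\<^sup>2"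
      unfolding minus_divide_left by (simp add: power2_eq_square algebra_simps)
    also have "\<dots> = (q z)\<^sup>2" by (simp add: hyperbolic_pythagoras q_def log_tanh_grad_def power_divide)
    finally have "(deriv B has_field_derivative (q z)\<^sup>2) (at z)"
      by (rule has_field_derivative_transform_within_open[OF _ \<Omega> z]) (simp add: B1)
    thus ?thesis by (rule DERIV_imp_deriv)
  qed
  show "associated_c0 \<Omega> A k (r\<^sup>2)"
    unfolding associated_c0_def holomorphic_log_on_def
  proof (intro exI[of _ B] conjI ballI holB)
    fix z assume z: "z \<in> \<Omega>"
    show "exp (B z) = of_real (sqrt k) * deriv A z" by (simp add: expB[OF z] A'[OF z])
    have nz: "sinh (r * z) \<noteq> 0" using sinh0[OF z] by simp
    have "exp (2 * B z) + r\<^sup>2 = r\<^sup>2 / (sinh (r * z))\<^sup>2 + r\<^sup>2"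
      by (simp add: exp_double expB[OF z] q_def log_tanh_grad_def power_divide)
    also have "\<dots> = r\<^sup>2 * (1 + (sinh (r * z))\<^sup>2) / (sinh (r * z))\<^sup>2"
      using nz by (simp add: field_simps)
    finally show "(deriv B z)\<^sup>2 = exp (2 * B z) + r\<^sup>2"
      by (simp add: B1[OF z] power_divide power_mult_distrib cosh_square_eq add.commute)
  qed
  define L where "L = (\<lambda>z. B z - of_real (ln (sqrt k)))"
  have dL: "deriv L z = deriv B z" if z: "z \<in> \<Omega>" for z
    using DERIV_imp_deriv[OF DERIV_diff[OF dB[OF z] DERIV_const]] B1[OF z] unfolding L_def by simp
  show "associated_k \<Omega> A k"
    unfolding associated_k_def holomorphic_log_on_def
  proof (intro exI[of _ L] conjI ballI)
    show "L holomorphic_on \<Omega>" unfolding L_def by (intro holomorphic_intros holB)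
    fix z assume z: "z \<in> \<Omega>"
    have "exp (complex_of_real (ln (sqrt k))) = of_real (sqrt k)" using k by (simp add: exp_of_real)
    thus "exp (L z) = deriv A z" using sk by (simp add: L_def exp_diff expB[OF z] flip: A'[OF z])
    have "eventually (\<lambda>z. z \<in> \<Omega>) (nhds z)" using \<Omega> z by (rule eventually_nhds_in_open)
    hence "eventually (\<lambda>z. deriv L z = deriv B z) (nhds z)"
      by (rule eventually_mono) (rule dL)
    hence "deriv (deriv L) z = deriv (deriv B) z" by (rule deriv_cong_ev) simp
    also have "\<dots> = of_real k * (deriv A z)\<^sup>2"
      using k by (simp add: B2[OF z] power_mult_distrib flip: A'[OF z] of_real_power)
    finally show "deriv (deriv L) z = of_real k * (deriv A z)\<^sup>2" .
  qed
qed

text \<open>The surfaces are \<Phi>(v) and \<Psi>(v), for antiderivatives \<Phi> and \<Psi> of the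
  reciprocal speeds with moduli \<gamma> and \<Lambda>; with K the inverse of \<Phi>, the
  transformation \<Psi>(K) carries one to the other.\<close>

lemma elliptic_pair_exists:
  assumes r: "r \<noteq> 0" and k: "k > 0" and \<gamma>: "0 < \<gamma>" "\<gamma> < 1" and \<Lambda>: "0 < \<Lambda>" "\<Lambda> < 1" and neq: "\<gamma> \<noteq> \<Lambda>"
  shows "\<exists>\<Omega> f U g A. \<Omega> \<noteq> {} \<and> admissible_pair \<Omega> f U g \<and> associated_function \<Omega> f g A \<and>
           associated_k \<Omega> A k \<and> associated_c0 \<Omega> A k (r\<^sup>2) \<and> elliptic_representation \<Omega> f g (r\<^sup>2) r \<gamma> \<Lambda>"
proof -
  define c where "c = (cmod r)\<^sup>2"
  have c: "c > 0" using r by (simp add: c_def)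
  obtain m where m: "m > 0" and P\<gamma>: "\<And>t. t \<in> {-m..0} \<Longrightarrow> profile_speed c \<gamma> t > 0"
    and P\<Lambda>: "\<And>t. t \<in> {-m..0} \<Longrightarrow> profile_speed c \<Lambda> t > 0"
    using common_speed_interval[OF c \<gamma> \<Lambda>] by metis
  \<comment> \<open>Excluding 0 makes \<open>K\<close> negative throughout, so the first
    characteristic function cannot vanish.\<close>
  define V where "V = {-m<..<0}"
  have V: "profile_speed c \<gamma> t > 0" "profile_speed c \<Lambda> t > 0" "t < 0" if "t \<in> V" for t
    using that P\<gamma>[of t] P\<Lambda>[of t] by (auto simp: V_def)
  obtain \<Phi> K where U: "open (\<Phi> ` V)" and K\<Phi>: "\<And>t. t \<in> V \<Longrightarrow> K (\<Phi> t) = t"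
    and d\<Phi>: "\<And>t. t \<in> V \<Longrightarrow> (\<Phi> has_real_derivative 1 / profile_speed c \<gamma> t) (at t)"
    and dK: "\<And>t. t \<in> V \<Longrightarrow> (K has_real_derivative profile_speed c \<gamma> t) (at (\<Phi> t))"
    unfolding V_def using profile_exists[OF c P\<gamma>] by metis
  obtain \<Psi> J where J\<Psi>: "\<And>t. t \<in> V \<Longrightarrow> J (\<Psi> t) = t"
    and d\<Psi>: "\<And>t. t \<in> V \<Longrightarrow> (\<Psi> has_real_derivative 1 / profile_speed c \<Lambda> t) (at t)"
    and dJ: "\<And>t. t \<in> V \<Longrightarrow> (J has_real_derivative profile_speed c \<Lambda> t) (at (\<Psi> t))"
    unfolding V_def using profile_exists[OF c P\<Lambda>] by metis
  obtain \<Omega> where \<Omega>: "\<Omega> \<noteq> {}" "open \<Omega>" "convex \<Omega>"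
    and sinh: "\<And>z. z \<in> \<Omega> \<Longrightarrow> sinh (r * z) \<notin> \<real>\<^sub>\<le>\<^sub>0" and tanh: "\<And>z. z \<in> \<Omega> \<Longrightarrow> tanh (r * z / 2) \<notin> \<real>\<^sub>\<le>\<^sub>0"
    and vV: "\<And>z. z \<in> \<Omega> \<Longrightarrow> log_tanh r 0 z \<in> V"
    unfolding V_def using log_tanh_domain_exists[OF r m] by metis
  have conn: "connected \<Omega>" using \<Omega>(3) by (rule convex_connected)
  have sinh0: "sinh (r * (z + 0)) \<noteq> 0" if "z \<in> \<Omega>" for z using sinh[OF that] by auto
  have tanh0: "tanh (r * (z + 0) / 2) \<noteq> 0" if "z \<in> \<Omega>" for z using tanh[OF that] by auto
  define v where "v = log_tanh r 0"
  define f where "f = (\<lambda>z. \<Phi> (v z))"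
  define U' where "U' = \<Phi> ` V"
  define g where "g = (\<lambda>s. \<Psi> (K s))"
  define P where "P = (\<lambda>s. profile_speed c \<gamma> (K s))"
  define Q where "Q = (\<lambda>s. profile_speed c \<Lambda> (K s))"
  define g1 where "g1 = (\<lambda>s. P s * (1 / Q s))"
  have fU: "f z \<in> U'" if "z \<in> \<Omega>" for z using vV[OF that] by (simp add: f_def U'_def v_def)
  have Kf: "K (f z) = v z" if "z \<in> \<Omega>" for z using K\<Phi>[OF vV[OF that]] by (simp add: f_def v_def)
  have KV: "K s \<in> V" if "s \<in> U'" for s using that K\<Phi> by (auto simp: U'_def)
  have PQ: "P s > 0" "Q s > 0" if "s \<in> U'" for s
    using V[OF KV[OF that]] by (auto simp: P_def Q_def)
  have K: "(K has_real_derivative P s) (at s)" if "s \<in> U'" for s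
    using that dK K\<Phi> by (auto simp: U'_def P_def)
  have g: "(g has_real_derivative g1 s) (at s)" if s: "s \<in> U'" for s
    using DERIV_chain2[OF d\<Psi>[OF KV[OF s]] K[OF s]] by (simp add: g_def g1_def Q_def)
  note trans = smooth_line_profile_transition[of U' c \<gamma> K \<Lambda> g,
      OF U[folded U'_def] PQ[unfolded P_def Q_def] K[unfolded P_def] g[unfolded g1_def P_def Q_def]]
  have K1: "(P has_real_derivative - (c * sinh (K s) * cosh (K s))) (at s)" if "s \<in> U'" for s
    unfolding P_def by (rule trans(2)[OF _ _ _ _ that])
  have g2: "(g1 has_real_derivative c * sinh (K s) * cosh (K s) / P s * (g1 s ^ 3 - g1 s)) (at s)"
    if "s \<in> U'" for s
    using trans(3)[OF _ _ _ _ that] unfolding g1_def P_def Q_def by simp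
  have deriv_g: "deriv g s = g1 s" if "s \<in> U'" for s by (rule DERIV_imp_deriv[OF g[OF that]])
  have deriv_g2: "deriv (deriv g) s = c * sinh (K s) * cosh (K s) / P s * (g1 s ^ 3 - g1 s)" if s: "s \<in> U'" for s
    by (rule DERIV_imp_deriv, rule has_field_derivative_transform_within_open[OF g2[OF s] U[folded U'_def] s])
       (simp add: deriv_g)
  have g1_pos: "g1 s > 0" if "s \<in> U'" for s using PQ[OF that] by (simp add: g1_def)
  have P2: "(P s)\<^sup>2 = c * (\<gamma>\<^sup>2 / (1 - \<gamma>\<^sup>2) - (sinh (K s))\<^sup>2)" if "s \<in> U'" for s
    using PQ(1)[OF that] unfolding P_def profile_speed_def by simp
  have Q2: "(Q s)\<^sup>2 = c * (\<Lambda>\<^sup>2 / (1 - \<Lambda>\<^sup>2) - (sinh (K s))\<^sup>2)" if "s \<in> U'" for s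
    using PQ(2)[OF that] unfolding Q_def profile_speed_def by simp
  \<comment> \<open>The place where \<gamma> and \<Lambda> must differ: g' is a positive ratio of
    speeds, and it equals 1 exactly when the two energy constants coincide.\<close>
  have g1_cubic: "g1 s ^ 3 - g1 s \<noteq> 0" if s: "s \<in> U'" for s
  proof
    assume "g1 s ^ 3 - g1 s = 0"
    hence "g1 s * ((g1 s)\<^sup>2 - 1) = 0" by (simp add: algebra_simps power2_eq_square power3_eq_cube)
    hence "(g1 s)\<^sup>2 = 1" using g1_pos[OF s] by simp
    hence "(P s)\<^sup>2 = (Q s)\<^sup>2" using PQ[OF s] by (simp add: g1_def power_divide)
    hence "\<gamma>\<^sup>2 / (1 - \<gamma>\<^sup>2) = \<Lambda>\<^sup>2 / (1 - \<Lambda>\<^sup>2)" using c unfolding P2[OF s] Q2[OF s] by simp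
    moreover have "1 - \<gamma>\<^sup>2 > 0" "1 - \<Lambda>\<^sup>2 > 0" using \<gamma> \<Lambda> by (auto simp: abs_square_less_1)
    ultimately have "\<gamma>\<^sup>2 = \<Lambda>\<^sup>2" by (simp add: frac_eq_eq algebra_simps)
    thus False using neq \<gamma> \<Lambda> by simp
  qed
  have h: "first_characteristic g s = c * sinh (K s) * cosh (K s) / P s" if s: "s \<in> U'" for s
    using g1_cubic[OF s] by (simp add: first_characteristic_def deriv_g2[OF s] deriv_g[OF s])

  have f_min: "minimal_graph_surface \<Omega> f" and f_grad: "\<And>z. z \<in> \<Omega> \<Longrightarrow> (dx f z)\<^sup>2 + (dy f z)\<^sup>2 \<noteq> 0"
    using profile_minimal_graph[OF \<Omega>(2) conn r vV sinh0 c_def V(1) K\<Phi> d\<Phi> dK, of f] by (auto simp: f_def v_def)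
  have gf_min: "minimal_graph_surface \<Omega> (g \<circ> f)"
    by (rule profile_minimal_graph(1)[OF \<Omega>(2) conn r vV sinh0 c_def V(2) J\<Psi> d\<Psi> dJ])
       (simp_all add: g_def Kf, simp add: v_def)
  have adm: "admissible_pair \<Omega> f U' g"
    unfolding admissible_pair_def minimal_graph_transformation_def
  proof (intro conjI ballI)
    show "simply_connected \<Omega>" by (rule convex_imp_simply_connected[OF \<Omega>(3)])
    show "minimal_graph_surface \<Omega> f" "minimal_graph_surface \<Omega> (g \<circ> f)" by (fact f_min gf_min)+
    show "(dx f z)\<^sup>2 + (dy f z)\<^sup>2 \<noteq> 0" if "z \<in> \<Omega>" for z by (rule f_grad[OF that])
    show "open U'" using U by (simp add: U'_def)
    show "smooth_line U' g" by (rule trans(1))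
    show "f ` \<Omega> \<subseteq> U'" using fU by auto
    show "(deriv g s) ^ 3 - deriv g s \<noteq> 0" if "s \<in> U'" for s
      using g1_cubic[OF that] by (simp add: deriv_g[OF that])
    fix s assume "s \<in> f ` \<Omega>"
    hence s: "s \<in> U'" using fU by auto
    show "first_characteristic g s \<noteq> 0"
      using c PQ[OF s] V(3)[OF KV[OF s]] by (simp add: h[OF s])
  qed

  define A where "A = (\<lambda>z. Ln (tanh (r * z / 2)) / of_real (sqrt k))"
  have A: "A holomorphic_on \<Omega>" "associated_k \<Omega> A k" "associated_c0 \<Omega> A k (r\<^sup>2)"
    unfolding A_def using associated_constants_Ln_tanh[OF \<Omega>(2) r k] sinh tanh by blast+
  define b where "b = 2 / sqrt k"
  have b: "b > 0" using k by (simp add: b_def)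
  have assoc: "associated_function \<Omega> f g A"
    unfolding associated_function_def
  \<comment> \<open>The choice H = b K is forced by A + cnj A = 2 v / sqrt k. Then exp (- H1) has to
    be H' = b P, hence H1 = - ln (b P), whose derivative - P' / P is the first
    characteristic.\<close>
  proof (rule conjI[OF A(1)], rule exI[of _ "\<lambda>s. - ln (b * P s)"], rule exI[of _ "\<lambda>s. b * K s"], intro conjI ballI)
    fix s assume "s \<in> f ` \<Omega>"
    hence s: "s \<in> U'" using fU by auto
    have bP: "b * P s > 0" using b PQ[OF s] by simp
    show "((\<lambda>s. - ln (b * P s)) has_real_derivative first_characteristic g s) (at s)"
      using DERIV_minus[OF DERIV_chain2[OF DERIV_ln_divide[OF bP] DERIV_cmult[OF K1[OF s], of b]]] b
      by (simp add: h[OF s])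
    show "((\<lambda>s. b * K s) has_real_derivative exp (- (- ln (b * P s)))) (at s)"
      using DERIV_cmult[OF K[OF s], of b] bP by simp
  next
    fix z assume z: "z \<in> \<Omega>"
    have "A z + cnj (A z) = complex_of_real (2 * Re (A z))" by (simp add: complex_eq_iff)
    also have "Re (A z) = v z / sqrt k"
      using tanh0[OF z] by (simp add: A_def v_def log_tanh_def Re_divide_of_real)
    finally show "complex_of_real (b * K (f z)) = A z + cnj (A z)" by (simp add: Kf[OF z] b_def)
  qed

  have cont: "continuous_on \<Omega> f"
    using f_min smooth_plane_differentiable(1) unfolding minimal_graph_surface_def
    by (meson continuous_at_imp_continuous_on differentiable_imp_continuous_within)
  have "elliptic_representation \<Omega> f g (r\<^sup>2) r \<gamma> \<Lambda>"
  proof (rule elliptic_representation_of_profile[OF conn cont gf_min \<gamma> \<Lambda>,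
        where K = K and ?K1.0 = P and ?g1.0 = g1 and ?c1.0 = 0])
    show "r\<^sup>2 \<noteq> 0" using r by simp
    show "tanh (r * (z + 0) / 2) \<noteq> 0" if "z \<in> \<Omega>" for z by (rule tanh0[OF that])
    show "K (f z) = ln (cmod (tanh (r * (z + 0) / 2)))" if "z \<in> \<Omega>" for z
      by (simp add: Kf[OF that] v_def log_tanh_def)
    have sub: "s \<in> U'" if "s \<in> f ` \<Omega>" for s using that fU by auto
    show "(K has_real_derivative P s) (at s)" "(g has_real_derivative g1 s) (at s)"
      "P s \<noteq> 0" "g1 s \<noteq> 0" "K s \<noteq> 0" if "s \<in> f ` \<Omega>" for s
      using K[OF sub[OF that]] g[OF sub[OF that]] PQ[OF sub[OF that]] g1_pos[OF sub[OF that]]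
        V(3)[OF KV[OF sub[OF that]]] by auto
    show "continuous_on (f ` \<Omega>) P"
      using K1 sub by (meson DERIV_isCont continuous_at_imp_continuous_on)
    show "continuous_on (f ` \<Omega>) g1"
      using g2 sub by (meson DERIV_isCont continuous_at_imp_continuous_on)
    show "(P s)\<^sup>2 = cmod (r\<^sup>2) * (\<gamma>\<^sup>2 / (1 - \<gamma>\<^sup>2) - (sinh (K s))\<^sup>2)" if "s \<in> f ` \<Omega>" for s
      by (simp add: P2[OF sub[OF that]] c_def norm_power)
    show "(P s)\<^sup>2 = (g1 s)\<^sup>2 * (cmod (r\<^sup>2) * (\<Lambda>\<^sup>2 / (1 - \<Lambda>\<^sup>2) - (sinh (K s))\<^sup>2))" if "s \<in> f ` \<Omega>" for s
    proof -
      have "(P s)\<^sup>2 = (g1 s)\<^sup>2 * (Q s)\<^sup>2" using PQ[OF sub[OF that]] by (simp add: g1_def power_divide)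
      thus ?thesis by (simp add: Q2[OF sub[OF that]] c_def norm_power)
    qed
  qed
  with \<Omega>(1) adm assoc A(2,3) show ?thesis by blast
qed

text \<open>The second conjunct makes precise that the moduli are arbitrary parameters. Equal moduli
  have to be excluded: both graph formulas share \<open>c1\<close>, so g would be s or - s up to a
  constant on f(\<Omega>), giving g'^3 - g' = 0 on a nonempty domain.\<close>

theorem mainTheorem6:
  fixes k :: real and c0 r :: complex
  assumes "k > 0" and "c0 \<noteq> 0" and "r\<^sup>2 = c0"
  shows "(\<forall>\<Omega> f U g A.
           admissible_pair \<Omega> f U g \<and> associated_function \<Omega> f g A \<and>
           associated_k \<Omega> A k \<and> associated_c0 \<Omega> A k c0 \<longrightarrow>
           (\<exists>\<gamma>\<in>{0<..<1}. \<exists>\<Lambda>\<in>{0<..<1}. elliptic_representation \<Omega> f g c0 r \<gamma> \<Lambda>)) \<and>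
         (\<forall>\<gamma>\<in>{0<..<1}. \<forall>\<Lambda>\<in>{0<..<1}. \<gamma> \<noteq> \<Lambda> \<longrightarrow>
           (\<exists>\<Omega> f U g A. \<Omega> \<noteq> {} \<and>
              admissible_pair \<Omega> f U g \<and> associated_function \<Omega> f g A \<and>
              associated_k \<Omega> A k \<and> associated_c0 \<Omega> A k c0 \<and>
              elliptic_representation \<Omega> f g c0 r \<gamma> \<Lambda>))"
proof (intro conjI allI impI ballI)
  have r: "r \<noteq> 0" using assms by auto
  fix \<Omega> f U g A
  assume *: "admissible_pair \<Omega> f U g \<and> associated_function \<Omega> f g A \<and>
           associated_k \<Omega> A k \<and> associated_c0 \<Omega> A k c0"
  show "\<exists>\<gamma>\<in>{0<..<1}. \<exists>\<Lambda>\<in>{0<..<1}. elliptic_representation \<Omega> f g c0 r \<gamma> \<Lambda>"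
  \<comment> \<open>The empty domain is admissible and the formulas hold vacuously on it, so any two
    moduli serve.\<close>
  proof (cases "\<Omega> = {}")
    case True
    have "minimal_graph_surface \<Omega> (g \<circ> f)"
      using * by (simp add: admissible_pair_def minimal_graph_transformation_def)
    hence "elliptic_representation \<Omega> f g c0 r (1/2) (1/2)"
      unfolding elliptic_representation_def cn_graph_def sd_transformation_def True by auto
    thus ?thesis by (intro bexI) auto
  next
    case False
    with * show ?thesis
      using admissible_pair_elliptic[OF _ False r assms(1), of f U g A] assms(3) by metis
  qed
next
  have r: "r \<noteq> 0" using assms by auto
  fix \<gamma> \<Lambda> :: real
  assume "\<gamma> \<in> {0<..<1}" "\<Lambda> \<in> {0<..<1}" "\<gamma> \<noteq> \<Lambda>"
  thus "\<exists>\<Omega> f U g A. \<Omega> \<noteq> {} \<and> admissible_pair \<Omega> f U g \<and> associated_function \<Omega> f g A \<and>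
              associated_k \<Omega> A k \<and> associated_c0 \<Omega> A k c0 \<and> elliptic_representation \<Omega> f g c0 r \<gamma> \<Lambda>"
    using elliptic_pair_exists[OF r assms(1), of \<gamma> \<Lambda>] unfolding assms(3) by simp
qed

end
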